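(* For every integer $t\ge0$, the semi-discretized conservative Hermite method for $u_t+u_x=0$ in the two cell-averaged variables $u_j$ (solution) and $v_j$ (spatial derivative), $$u_j'+\frac1h\left(\mathcal{F}_{j+1/2}-\mathcal{F}_{j-1/2}\right)=0,\qquad v_j'+\frac1h\left(\mathcal{H}_{j+1/2}-\mathcal{H}_{j-1/2}\right)=0,$$ with optimally accurate fluxes and stencil $(l,r)=(t+3,t)$, is unstable.
   Context: Uniform grid with cell faces $x_{j+1/2}$, spacing $h>0$. The unknowns approximate cell averages: $u_j(t)\approx\frac1h\int_{x_{j-1/2}}^{x_{j+1/2}}u(x,t)\,dx$ and $v_j(t)\approx\frac1h\int_{x_{j-1/2}}^{x_{j+1/2}}u_x(x,t)\,dx$, where $u$ solves $u_t+u_x=0$ (so $v=u_x$ solves $v_t+v_x=0$). Optimally accurate fluxes with stencil $(l,r)$: for each $j$, let $P$ be the polynomial of degree at most $2l+2r-1$ such that $$\frac1h\int_{x_{j+k-1/2}}^{x_{j+k+1/2}}P(x)\,dx=u_{j+k},\qquad \frac1h\int_{x_{j+k-1/2}}^{x_{j+k+1/2}}P'(x)\,dx=v_{j+k},\qquad -l+1\le k\le r;$$ then $\mathcal{F}_{j+1/2}=P(x_{j+1/2})$ and $\mathcal{H}_{j+1/2}=P'(x_{j+1/2})$. These fluxes are linear in $u_{j-l+1},\dots,u_{j+r},v_{j-l+1},\dots,v_{j+r}$. Stability is in the von Neumann sense: inserting $u_j(t)=\hat u(t)e^{ij\theta}$, $v_j(t)=\hat v(t)e^{ij\theta}$, $\theta\in[0,2\pi]$,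 reduces the scheme to a $2\times2$ linear ODE system $(\hat u,\hat v)^{T\prime}=-M(\theta)(\hat u,\hat v)^T$. Stability requires that all eigenvalues of $M(\theta)$ have non-negative real part for all $\theta\in[0,2\pi]$; the method is unstable if for some $\theta\in[0,2\pi]$ the matrix $M(\theta)$ has an eigenvalue with negative real part (i.e. an exponentially growing Fourier mode). *)

theory Defs
  imports "HOL-Analysis.Analysis" "HOL-Computational_Algebra.Polynomial"
begin

text \<open>
  Uniform grid: \<open>face a h j\<close> is the cell face $x_{j+1/2}$, where \<open>a\<close> is the position of
  $x_{1/2}$. Hence cell \<open>j\<close> is the interval from \<open>face a h (j - 1)\<close> to \<open>face a h j\<close>.

  Grid functions are complex valued, since the von Neumann analysis inserts complex
  exponentials; real data are a special case.
\<close>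

definition face :: "real \<Rightarrow> real \<Rightarrow> int \<Rightarrow> real" where
  "face a h j = a + of_int j * h"

definition cell_average :: "real \<Rightarrow> real \<Rightarrow> complex poly \<Rightarrow> int \<Rightarrow> complex" where
  "cell_average a h p j =
     (1 / h) *\<^sub>R integral {face a h (j - 1)..face a h j} (\<lambda>x. poly p (of_real x))"

definition hermite_interpolant ::
  "real \<Rightarrow> real \<Rightarrow> nat \<Rightarrow> nat \<Rightarrow> (int \<Rightarrow> complex) \<Rightarrow> (int \<Rightarrow> complex) \<Rightarrow> int \<Rightarrow> complex poly \<Rightarrow> bool"
where
  "hermite_interpolant a h l r u v j P \<longleftrightarrow>
     degree P \<le> 2 * l + 2 * r - 1 \<and>
     (\<forall>k\<in>{- int l + 1..int r}.
        cell_average a h P (j + k) = u (j + k) \<and>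
        cell_average a h (pderiv P) (j + k) = v (j + k))"

text \<open>
  For \<open>h > 0\<close> and \<open>l + r > 0\<close> the interpolant exists and is unique, so the description
  operator below is meaningful.
\<close>

definition reconstruction ::
  "real \<Rightarrow> real \<Rightarrow> nat \<Rightarrow> nat \<Rightarrow> (int \<Rightarrow> complex) \<Rightarrow> (int \<Rightarrow> complex) \<Rightarrow> int \<Rightarrow> complex poly"
where
  "reconstruction a h l r u v j = (THE P. hermite_interpolant a h l r u v j P)"

text \<open>\<open>flux_F \<dots> j\<close> and \<open>flux_H \<dots> j\<close> are the fluxes at the face $x_{j+1/2}$.\<close>

definition flux_F ::
  "real \<Rightarrow> real \<Rightarrow> nat \<Rightarrow> nat \<Rightarrow> (int \<Rightarrow> complex) \<Rightarrow> (int \<Rightarrow> complex) \<Rightarrow> int \<Rightarrow> complex"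
where
  "flux_F a h l r u v j = poly (reconstruction a h l r u v j) (of_real (face a h j))"

definition flux_H ::
  "real \<Rightarrow> real \<Rightarrow> nat \<Rightarrow> nat \<Rightarrow> (int \<Rightarrow> complex) \<Rightarrow> (int \<Rightarrow> complex) \<Rightarrow> int \<Rightarrow> complex"
where
  "flux_H a h l r u v j = poly (pderiv (reconstruction a h l r u v j)) (of_real (face a h j))"

text \<open>The semi-discrete equations hold at time \<open>s\<close>; \<open>u s j\<close> is $u_j(s)$.\<close>

definition scheme_at ::
  "real \<Rightarrow> real \<Rightarrow> nat \<Rightarrow> nat \<Rightarrow> (real \<Rightarrow> int \<Rightarrow> complex) \<Rightarrow> (real \<Rightarrow> int \<Rightarrow> complex) \<Rightarrow> real \<Rightarrow> bool"
where
  "scheme_at a h l r u v s \<longleftrightarrow>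
     (\<forall>j. ((\<lambda>s. u s j) has_vector_derivative
             - ((1 / h) *\<^sub>R (flux_F a h l r (u s) (v s) j - flux_F a h l r (u s) (v s) (j - 1))))
           (at s) \<and>
          ((\<lambda>s. v s j) has_vector_derivative
             - ((1 / h) *\<^sub>R (flux_H a h l r (u s) (v s) j - flux_H a h l r (u s) (v s) (j - 1))))
           (at s))"

text \<open>
  \<open>M\<close> is the matrix $M(\theta)$: for a pair \<open>w\<close> of time-dependent amplitudes, the Fourier mode
  with these amplitudes satisfies the scheme exactly when \<open>w' = - M w\<close>. Demanding this at each
  single time determines \<open>M\<close> uniquely, since value and derivative of \<open>w\<close> at one time can be
  prescribed independently.
\<close>

definition von_neumann_matrix ::
  "real \<Rightarrow> real \<Rightarrow> nat \<Rightarrow> nat \<Rightarrow> real \<Rightarrow> complex^2^2 \<Rightarrow> bool"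
where
  "von_neumann_matrix a h l r \<theta> M \<longleftrightarrow>
     (\<forall>(w :: real \<Rightarrow> complex^2) s.
        scheme_at a h l r
          (\<lambda>s j. w s $ 1 * exp (\<i> * of_int j * of_real \<theta>))
          (\<lambda>s j. w s $ 2 * exp (\<i> * of_int j * of_real \<theta>)) s
        \<longleftrightarrow> (w has_vector_derivative - (M *v w s)) (at s))"

definition eigenvalue_of :: "complex^2^2 \<Rightarrow> complex \<Rightarrow> bool" where
  "eigenvalue_of M \<mu> \<longleftrightarrow> (\<exists>z. z \<noteq> 0 \<and> M *v z = \<mu> *s z)"

definition von_neumann_unstable :: "real \<Rightarrow> real \<Rightarrow> nat \<Rightarrow> nat \<Rightarrow> bool" where
  "von_neumann_unstable a h l r \<longleftrightarrow>
     (\<exists>\<theta>\<in>{0..2 * pi}. \<exists>M \<mu>. von_neumann_matrix a h l r \<theta> M \<and> eigenvalue_of M \<mu> \<and> Re \<mu> < 0)"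

end

theory Submission imports Defs begin

text \<open>
  At $\theta=\pi$ the matrix $M(\pi)$ has negative trace, hence an eigenvalue with negative real
  part. Let $n=l+r=2t+3$ and let $Q$ be an antiderivative of the reconstruction, rescaled so that
  the cell faces are $0,\dots,n$; the flux face is $l=t+3$. The trace is a positive multiple of
  $Q_A'(l)+Q_B''(l)$, where $Q_A$ belongs to the alternating data $u=(-1)^j$, $v=0$ and $Q_B$ to
  $u=0$, $v=(-1)^j$.

  The derivative $Q_A'$ has the same value at all nodes, and Hermite interpolation expresses it
  through $\sum_m(-1)^m\binom nm^2(H_m-H_{n-m})$. This is, up to a positive factor, the derivative
  at $y=n$ of a terminating sum of Kummer type that factors as $c\prod_k(2k-1-y)$.

  For $Q_B$, vanishing at the nodes, $Q_B(x+1)+Q_B(x)=\kappa\,(x(x-1)\cdots(x-n+1))^2$ because the left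
  side has double zeros at $0,\dots,n-1$. Since $Q_B$ is symmetric about $n/2$, this relation yields
  $Q_B''$ at all nodes, and the sign of $\kappa$ follows from finite differences of
  $Q_B/\prod_m(x-m)$, which equals a multiple of $\binom nm$ at the node $m$.
\<close>

section \<open>Hermite interpolation\<close>

definition node_poly :: "'a::idom set \<Rightarrow> 'a poly" where
  "node_poly X = (\<Prod>x\<in>X. [:- x, 1:])"

lemma pderiv_sum: "pderiv (\<Sum>x\<in>A. f x) = (\<Sum>x\<in>A. pderiv (f x))"
  by (induction A rule: infinite_finite_induct) (auto simp: pderiv_add)

lemma node_poly_empty [simp]: "node_poly {} = 1"
  by (simp add: node_poly_def)

lemma node_poly_insert [simp]:
  "finite X \<Longrightarrow> x \<notin> X \<Longrightarrow> node_poly (insert x X) = [:- x, 1:] * node_poly X"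
  by (simp add: node_poly_def)

lemma node_poly_remove:
  "finite X \<Longrightarrow> x \<in> X \<Longrightarrow> node_poly X = [:- x, 1:] * node_poly (X - {x})"
  by (simp add: node_poly_def prod.remove)

lemma node_poly_ne_0 [simp]: "finite X \<Longrightarrow> node_poly X \<noteq> 0"
  by (auto simp: node_poly_def)

lemma poly_node_poly_eq_0_iff: "finite X \<Longrightarrow> poly (node_poly X) x = 0 \<longleftrightarrow> x \<in> X"
  by (auto simp: node_poly_def poly_prod)

lemma degree_node_poly [simp]: "finite X \<Longrightarrow> degree (node_poly X) = card X"
  by (induction X rule: finite_induct) (auto simp: degree_mult_eq simp del: mult_pCons_left)

lemma lead_coeff_node_poly [simp]: "lead_coeff (node_poly X) = 1"
  by (simp add: node_poly_def lead_coeff_prod)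

lemma poly_pderiv_node_poly:
  fixes x :: "'a::field"
  assumes "finite X" "x \<notin> X"
  shows "poly (pderiv (node_poly X)) x = poly (node_poly X) x * (\<Sum>y\<in>X. 1 / (x - y))"
  using assms
proof (induction X rule: finite_induct)
  case (insert y X)
  then have "x - y \<noteq> 0" by auto
  then show ?case using insert
    by (simp add: pderiv_mult pderiv_pCons field_simps del: mult_pCons_left mult_pCons_right)
qed (simp add: pderiv_1)

lemma poly_pderiv_node_poly_at_node:
  assumes "finite X" "x \<in> X"
  shows "poly (pderiv (node_poly X)) x = poly (node_poly (X - {x})) x"
  unfolding node_poly_remove[OF assms] by (simp add: pderiv_mult pderiv_pCons del: mult_pCons_left)

text \<open>Split off one node at a time: in an integral domain the remaining factor still vanishes
  at the other nodes, where the linear factor is nonzero.\<close>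

lemma node_poly_dvd:
  assumes "finite X" "\<And>x. x \<in> X \<Longrightarrow> poly Q x = 0"
  shows "node_poly X dvd Q"
  using assms
proof (induction X arbitrary: Q rule: finite_induct)
  case (insert x X)
  obtain R where R: "Q = [:- x, 1:] * R"
    using insert.prems[of x] by (auto simp: poly_eq_0_iff_dvd)
  have "poly R y = 0" if "y \<in> X" for y
    using insert.prems[of y] insert.hyps(2) that R by auto
  then have "node_poly X dvd R" by (rule insert.IH)
  then show ?case using insert.hyps R by (simp del: mult_pCons_left add: mult_dvd_mono)
qed simp

text \<open>After one division by \<open>node_poly X\<close>, the derivative at a node reduces to
  the product of its differences to the other nodes times the quotient. That product is nonzero, so
  the quotient vanishes at every node as well.\<close>

lemma node_poly_square_dvd:
  fixes Q :: "'a::idom poly"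
  assumes "finite X"
    and "\<And>x. x \<in> X \<Longrightarrow> poly Q x = 0" "\<And>x. x \<in> X \<Longrightarrow> poly (pderiv Q) x = 0"
  shows "(node_poly X)\<^sup>2 dvd Q"
proof -
  obtain R where R: "Q = node_poly X * R"
    using node_poly_dvd[OF assms(1,2)] by (metis dvdE)
  have "poly R x = 0" if x: "x \<in> X" for x
  proof -
    have "poly (node_poly X) x = 0" using x assms(1) by (simp add: poly_node_poly_eq_0_iff)
    then have "poly (node_poly (X - {x})) x * poly R x = 0"
      using assms(3)[OF x] x assms(1) R
      by (simp add: pderiv_mult poly_pderiv_node_poly_at_node mult.commute)
    then show ?thesis using assms(1) by (auto simp: poly_node_poly_eq_0_iff)
  qed
  then have "node_poly X dvd R" by (rule node_poly_dvd[OF assms(1)])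
  then show ?thesis by (simp add: R power2_eq_square)
qed

lemma hermite_unique:
  fixes Q :: "'a::idom poly"
  assumes "finite X" "degree Q < 2 * card X"
    and "\<And>x. x \<in> X \<Longrightarrow> poly Q x = 0" "\<And>x. x \<in> X \<Longrightarrow> poly (pderiv Q) x = 0"
  shows "Q = 0"
proof (rule ccontr)
  assume "Q \<noteq> 0"
  then have "degree ((node_poly X)\<^sup>2) \<le> degree Q"
    using node_poly_square_dvd[OF assms(1,3,4)] by (intro dvd_imp_degree_le)
  then show False using assms(1,2) by (simp add: degree_power_eq)
qed

text \<open>The formula for the leading coefficient is the divided difference on doubled nodes.\<close>

lemma hermite_exists:
  fixes X :: "'a::field set" and q p :: "'a \<Rightarrow> 'a"
  assumes "finite X" "X \<noteq> {}"
  obtains Q where "degree Q \<le> 2 * card X - 1"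
    "\<And>x. x \<in> X \<Longrightarrow> poly Q x = q x" "\<And>x. x \<in> X \<Longrightarrow> poly (pderiv Q) x = p x"
    "coeff Q (2 * card X - 1) =
       (\<Sum>x\<in>X. (p x - 2 * (\<Sum>y\<in>X - {x}. 1 / (x - y)) * q x) / (poly (node_poly (X - {x})) x)\<^sup>2)"
proof -
  define N where "N = card X"
  have N: "N > 0" using assms by (auto simp: N_def card_gt_0_iff)
  define L where "L x = node_poly (X - {x})" for x
  define w where "w x = poly (L x) x" for x
  \<comment> \<open>Twice the sum of reciprocals is the logarithmic derivative of
    \<open>(L x)\<^sup>2\<close> at \<open>x\<close>, so \<open>d x\<close> is the slope that the
    linear factor of \<open>B x\<close> needs for the derivative \<open>p x\<close>.\<close>
  define d where "d x = p x - 2 * (\<Sum>y\<in>X - {x}. 1 / (x - y)) * q x" for x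
  \<comment> \<open>The square has double zeros at all other nodes; the linear factor is
    \<open>q x\<close> plus \<open>d x\<close> times the distance from \<open>x\<close>.\<close>
  define B where "B x = smult (1 / (w x)\<^sup>2) ((L x)\<^sup>2 * [: q x - d x * x, d x :])" for x
  define Q where "Q = (\<Sum>x\<in>X. B x)"
  have w0: "w x \<noteq> 0" if "x \<in> X" for x
    using assms by (simp add: w_def L_def poly_node_poly_eq_0_iff)
  have degL: "degree ((L x)\<^sup>2) = 2 * N - 2" if "x \<in> X" for x
    using assms that by (simp add: L_def degree_power_eq N_def card_Diff_singleton)
  have lcL: "coeff ((L x)\<^sup>2) (2 * N - 2) = 1" if "x \<in> X" for x
    using degL[OF that] lead_coeff_power[of "L x" 2] by (simp add: L_def)
  have dB: "degree (B x) \<le> 2 * N - 1" if "x \<in> X" for x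
  proof -
    have "degree (B x) \<le> degree ((L x)\<^sup>2) + degree [: q x - d x * x, d x :]"
      unfolding B_def by (intro order.trans[OF degree_smult_le] degree_mult_le)
    also have "\<dots> \<le> (2 * N - 2) + 1" using degL[OF that] by (intro add_mono) auto
    finally show ?thesis using N by simp
  qed
  have cB: "coeff (B x) (2 * N - 1) = d x / (w x)\<^sup>2" if "x \<in> X" for x
  proof -
    have "Suc (2 * N - 2) = 2 * N - 1" using N by simp
    then have "coeff ((L x)\<^sup>2) (2 * N - 1) = 0" using degL[OF that] by (intro coeff_eq_0) simp
    moreover have "coeff (pCons 0 ((L x)\<^sup>2)) (2 * N - 1) = 1"
      using lcL[OF that] \<open>Suc (2 * N - 2) = 2 * N - 1\<close> by (metis coeff_pCons_Suc)
    moreover have "coeff (pCons 0 (smult (d x) ((L x)\<^sup>2))) (2 * N - 1)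
        = d x * coeff (pCons 0 ((L x)\<^sup>2)) (2 * N - 1)"
      by (metis coeff_smult smult_0_right smult_pCons mult_zero_right)
    ultimately show ?thesis by (simp add: B_def)
  qed
  have own: "poly (B x) x = q x" "poly (pderiv (B x)) x = p x" if "x \<in> X" for x
  proof -
    show "poly (B x) x = q x"
      using w0[OF that] by (simp add: B_def w_def[symmetric] algebra_simps)
    have "poly (pderiv (L x)) x = w x * (\<Sum>y\<in>X - {x}. 1 / (x - y))"
      unfolding w_def L_def using assms by (intro poly_pderiv_node_poly) auto
    then show "poly (pderiv (B x)) x = p x"
      using w0[OF that]
      by (simp add: B_def pderiv_smult pderiv_mult pderiv_pCons pderiv_power_Suc power2_eq_square
          w_def[symmetric] field_simps del: mult_pCons_left mult_pCons_right)
        (simp add: d_def field_simps)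
  qed
  have other: "poly (B x) y = 0 \<and> poly (pderiv (B x)) y = 0" if "x \<in> X" "y \<in> X" "x \<noteq> y" for x y
  proof -
    have "poly (L x) y = 0" using that assms by (simp add: L_def poly_node_poly_eq_0_iff)
    then show ?thesis
      by (simp add: B_def pderiv_smult pderiv_mult power2_eq_square
          del: mult_pCons_left mult_pCons_right)
  qed
  have "degree Q \<le> 2 * N - 1" unfolding Q_def using assms dB by (intro degree_sum_le) auto
  moreover have "poly Q x = q x" if "x \<in> X" for x
  proof -
    have "poly Q x = (\<Sum>y\<in>X. if y = x then q x else 0)"
      unfolding Q_def poly_sum using other own that by (intro sum.cong) auto
    then show ?thesis using assms that by simp
  qed
  moreover have "poly (pderiv Q) x = p x" if "x \<in> X" for x
  proof -
    have "poly (pderiv Q) x = (\<Sum>y\<in>X. if y = x then p x else 0)"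
      unfolding Q_def pderiv_sum poly_sum using other own that by (intro sum.cong) auto
    then show ?thesis using assms that by simp
  qed
  moreover have "coeff Q (2 * N - 1) = (\<Sum>x\<in>X. d x / (w x)\<^sup>2)"
    unfolding Q_def coeff_sum using cB by (intro sum.cong) auto
  ultimately show ?thesis using that unfolding N_def d_def w_def L_def by blast
qed

section \<open>Interpolation on consecutive integers\<close>

lemma card_of_nat_nodes [simp]: "card ((of_nat :: nat \<Rightarrow> 'a::semiring_char_0) ` {..n}) = Suc n"
  by (simp add: card_image)

text \<open>The nodes below \<open>m\<close> contribute \<open>fact m\<close>; each of the
  \<open>n - m\<close> nodes above contributes a negative factor, which yields the sign and
  \<open>fact (n - m)\<close>.\<close>

lemma prod_node_differences:
  assumes "m \<le> n"
  shows "(\<Prod>k\<in>{..n} - {m}. (of_nat m - of_nat k :: 'a::field_char_0))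
    = (- 1) ^ (n - m) * fact m * fact (n - m)"
  using assms
proof (induction n rule: dec_induct)
  case base
  have "{..m} - {m} = {..<m}" by auto
  moreover have "(\<Prod>k<m. (of_nat m - of_nat k :: 'a)) = (\<Prod>k<m. of_nat (Suc (m - Suc k)))"
    by (intro prod.cong refl) (simp add: of_nat_diff Suc_diff_Suc flip: of_nat_diff)
  moreover have "\<dots> = (\<Prod>k<m. of_nat (Suc k))"
    by (rule prod.nat_diff_reindex)
  ultimately show ?case by (simp add: fact_prod_Suc atLeast0LessThan)
next
  case (step n)
  then have "{..Suc n} - {m} = insert (Suc n) ({..n} - {m})" by auto
  moreover have "of_nat m - of_nat (Suc n) = (- of_nat (Suc n - m) :: 'a)"
    using step by (simp add: of_nat_diff)
  ultimately show ?case using step by (simp add: Suc_diff_le algebra_simps)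
qed

lemma sum_node_reciprocals:
  assumes "m \<le> n"
  shows "(\<Sum>k\<in>{..n} - {m}. 1 / (of_nat m - of_nat k :: 'a::real_normed_field))
    = harm m - harm (n - m)"
  using assms
proof (induction n rule: dec_induct)
  case base
  have "{..m} - {m} = {..<m}" by auto
  moreover have "(\<Sum>k<m. 1 / (of_nat m - of_nat k :: 'a)) = (\<Sum>k<m. inverse (of_nat (Suc (m - Suc k))))"
    by (intro sum.cong refl) (simp add: of_nat_diff Suc_diff_Suc inverse_eq_divide flip: of_nat_diff)
  moreover have "\<dots> = (\<Sum>k<m. inverse (of_nat (Suc k)))"
    by (rule sum.nat_diff_reindex)
  ultimately show ?case by (simp add: harm_altdef harm_def)
next
  case (step n)
  then have "{..Suc n} - {m} = insert (Suc n) ({..n} - {m})" by auto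
  moreover have "of_nat m - of_nat (Suc n) = (- of_nat (Suc (n - m)) :: 'a)"
    using step by (simp add: of_nat_diff)
  ultimately show ?case using step
    by (simp add: Suc_diff_le harm_Suc inverse_eq_divide del: of_nat_Suc)
qed

lemma of_nat_nodes_remove:
  "(of_nat :: nat \<Rightarrow> 'a::semiring_char_0) ` {..n} - {of_nat m} = of_nat ` ({..n} - {m})"
  by auto

lemma poly_node_poly_of_nat:
  assumes "m \<le> n"
  shows "poly (node_poly (of_nat ` {..n} - {of_nat m})) (of_nat m :: 'a::field_char_0)
    = (- 1) ^ (n - m) * fact m * fact (n - m)"
proof -
  have "poly (node_poly (of_nat ` {..n} - {of_nat m})) (of_nat m :: 'a)
      = (\<Prod>k\<in>{..n} - {m}. of_nat m - of_nat k)"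
    unfolding of_nat_nodes_remove node_poly_def poly_prod by (subst prod.reindex) auto
  then show ?thesis using prod_node_differences[OF assms] by simp
qed

lemma poly_pderiv_node_poly_of_nat:
  assumes "m \<le> n"
  shows "poly (pderiv (node_poly (of_nat ` {..n}))) (of_nat m :: 'a::field_char_0)
    = (- 1) ^ (n - m) * fact m * fact (n - m)"
  using assms by (simp add: poly_pderiv_node_poly_at_node poly_node_poly_of_nat)

text \<open>
  The interpolation problem prescribes $Q'$ at the $n+1$ nodes only up to a common constant. This
  relation, which says that the top coefficient of the Hermite interpolant vanishes, determines it.
\<close>

lemma hermite_functional:
  fixes Q :: "'a::real_normed_field poly"
  assumes "degree Q \<le> 2 * n"
  shows "(\<Sum>m\<le>n. (of_nat (n choose m))\<^sup>2 *
    (poly (pderiv Q) (of_nat m) - 2 * (harm m - harm (n - m)) * poly Q (of_nat m))) = 0"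
proof -
  let ?X = "of_nat ` {..n} :: 'a set"
  have card: "2 * card ?X - 1 = 2 * n + 1" by simp
  \<comment> \<open>Interpolate the data of \<open>Q\<close> itself. Uniqueness identifies
    \<open>S\<close> with \<open>Q\<close>, and the degree bound on \<open>Q\<close> makes the
    coefficient at \<open>2 * n + 1\<close> vanish.\<close>
  obtain S where S: "degree S \<le> 2 * n + 1"
    "\<And>x. x \<in> ?X \<Longrightarrow> poly S x = poly Q x" "\<And>x. x \<in> ?X \<Longrightarrow> poly (pderiv S) x = poly (pderiv Q) x"
    "coeff S (2 * n + 1) = (\<Sum>x\<in>?X. (poly (pderiv Q) x - 2 * (\<Sum>y\<in>?X - {x}. 1 / (x - y)) * poly Q x)
       / (poly (node_poly (?X - {x})) x)\<^sup>2)"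
    using hermite_exists[of ?X "poly Q" "poly (pderiv Q)"] unfolding card by blast
  have "degree (S - Q) < 2 * card ?X"
    using assms S(1) by (intro le_less_trans[OF degree_diff_le_max]) auto
  then have "S - Q = 0"
    using S(2,3) by (intro hermite_unique[of ?X]) (auto simp: pderiv_diff)
  then have "coeff S (2 * n + 1) = 0" using assms by (simp add: coeff_eq_0)
  then have "0 = (\<Sum>m\<le>n. (poly (pderiv Q) (of_nat m)
      - 2 * (\<Sum>y\<in>?X - {of_nat m}. 1 / (of_nat m - y)) * poly Q (of_nat m))
       / (poly (node_poly (?X - {of_nat m})) (of_nat m))\<^sup>2)"
    unfolding S(4) by (subst (asm) sum.reindex) auto
  also have "\<dots> = (\<Sum>m\<le>n. (of_nat (n choose m))\<^sup>2 *
    (poly (pderiv Q) (of_nat m) - 2 * (harm m - harm (n - m)) * poly Q (of_nat m)) / (fact n)\<^sup>2)"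
  proof (intro sum.cong refl)
    fix m assume "m \<in> {..n}"
    then have m: "m \<le> n" by simp
    have "(\<Sum>y\<in>?X - {of_nat m}. 1 / (of_nat m - y)) = (harm m - harm (n - m) :: 'a)"
      unfolding of_nat_nodes_remove using sum_node_reciprocals[OF m]
      by (subst sum.reindex) auto
    moreover have "z / (poly (node_poly (?X - {of_nat m})) (of_nat m))\<^sup>2
        = (of_nat (n choose m))\<^sup>2 * z / (fact n)\<^sup>2" for z :: 'a
      using m by (simp add: poly_node_poly_of_nat binomial_fact power2_eq_square)
    ultimately show "(poly (pderiv Q) (of_nat m)
        - 2 * (\<Sum>y\<in>?X - {of_nat m}. 1 / (of_nat m - y)) * poly Q (of_nat m))
         / (poly (node_poly (?X - {of_nat m})) (of_nat m))\<^sup>2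
      = (of_nat (n choose m))\<^sup>2 *
        (poly (pderiv Q) (of_nat m) - 2 * (harm m - harm (n - m)) * poly Q (of_nat m)) / (fact n)\<^sup>2"
      by (simp only:)
  qed
  finally show ?thesis by (simp flip: sum_divide_distrib)
qed

lemma sum_choose_square_ne_0 [simp]:
  "(\<Sum>m\<le>n. (of_nat (n choose m))\<^sup>2) \<noteq> (0 :: 'a::semiring_char_0)"
proof -
  have "(\<Sum>m\<le>n. (n choose m)\<^sup>2) \<noteq> 0" by (subst sum_eq_0_iff) auto
  then have "of_nat (\<Sum>m\<le>n. (n choose m)\<^sup>2) \<noteq> (0 :: 'a)" by (simp only: of_nat_eq_0_iff) simp
  then show ?thesis by (simp add: of_nat_sum)
qed

text \<open>
  Here \<open>Q\<close> is an antiderivative of the reconstruction, on the grid of spacing 1 with nodes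
  $0,\dots,n$. Cell averages become differences of values at the nodes.
\<close>

definition unit_interpolant ::
  "nat \<Rightarrow> (nat \<Rightarrow> 'a::real_normed_field) \<Rightarrow> (nat \<Rightarrow> 'a) \<Rightarrow> 'a poly \<Rightarrow> bool" where
  "unit_interpolant n U V Q \<longleftrightarrow> degree Q \<le> 2 * n \<and>
     (\<forall>m<n. poly Q (of_nat (Suc m)) - poly Q (of_nat m) = U m \<and>
            poly (pderiv Q) (of_nat (Suc m)) - poly (pderiv Q) (of_nat m) = V m)"

lemma poly_eq_partial_sum:
  assumes "\<forall>m<n. f (Suc m) - f m = (U m :: 'a::ab_group_add)" "m \<le> n"
  shows "f m = f 0 + (\<Sum>i<m. U i)"
  using assms by (induction m) (auto simp: algebra_simps)

text \<open>The values of \<open>Q\<close> and of its derivative at the nodes are partial sums of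
  the data, each up to an additive constant. The first constant is set to zero; the second lowers
  the degree of the Hermite interpolant from \<open>2 * n + 1\<close> to
  \<open>2 * n\<close>.\<close>

lemma unit_interpolant_exists:
  fixes U V :: "nat \<Rightarrow> 'a::real_normed_field"
  obtains Q where "unit_interpolant n U V Q"
proof -
  let ?X = "of_nat ` {..n} :: 'a set"
  define C :: "nat \<Rightarrow> 'a" where "C m = (of_nat (n choose m))\<^sup>2" for m
  define lam :: "nat \<Rightarrow> 'a" where "lam m = harm m - harm (n - m)" for m
  define u where "u m = (\<Sum>i<m. U i)" for m
  define v where "v m = (\<Sum>i<m. V i)" for m
  \<comment> \<open>Solves the linear equation that the coefficient at \<open>2 * n + 1\<close> is
    zero; the denominator is a nonzero sum of squares.\<close>
  define d where "d = - (\<Sum>m\<le>n. C m * (v m - 2 * lam m * u m)) / (\<Sum>m\<le>n. C m)"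
  \<comment> \<open>Hermite data are functions on the field, so the index of a node is recovered by
    inverting \<open>of_nat\<close>.\<close>
  define idx :: "'a \<Rightarrow> nat" where "idx = inv_into UNIV of_nat"
  have idx [simp]: "idx (of_nat m) = m" for m
    unfolding idx_def by (rule inv_into_f_f) (auto simp: inj_of_nat)
  have card: "2 * card ?X - 1 = 2 * n + 1" by simp
  obtain S where S: "degree S \<le> 2 * n + 1"
    "\<And>x. x \<in> ?X \<Longrightarrow> poly S x = u (idx x)" "\<And>x. x \<in> ?X \<Longrightarrow> poly (pderiv S) x = v (idx x) + d"
    "coeff S (2 * n + 1) = (\<Sum>x\<in>?X. (v (idx x) + d - 2 * (\<Sum>y\<in>?X - {x}. 1 / (x - y)) * u (idx x))
       / (poly (node_poly (?X - {x})) x)\<^sup>2)"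
    using hermite_exists[of ?X "\<lambda>x. u (idx x)" "\<lambda>x. v (idx x) + d"] unfolding card by blast
  have "coeff S (2 * n + 1) = (\<Sum>m\<le>n. (v m + d
      - 2 * (\<Sum>y\<in>?X - {of_nat m}. 1 / (of_nat m - y)) * u m)
       / (poly (node_poly (?X - {of_nat m})) (of_nat m))\<^sup>2)"
    unfolding S(4) by (subst sum.reindex) auto
  also have "\<dots> = (\<Sum>m\<le>n. C m * (v m + d - 2 * lam m * u m) / (fact n)\<^sup>2)"
  proof (intro sum.cong refl)
    fix m assume "m \<in> {..n}"
    then have m: "m \<le> n" by simp
    have "(\<Sum>y\<in>?X - {of_nat m}. 1 / (of_nat m - y)) = lam m"
      unfolding of_nat_nodes_remove lam_def using sum_node_reciprocals[OF m]
      by (subst sum.reindex) auto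
    moreover have "z / (poly (node_poly (?X - {of_nat m})) (of_nat m))\<^sup>2 = C m * z / (fact n)\<^sup>2"
      for z
      using m by (simp add: C_def poly_node_poly_of_nat binomial_fact power2_eq_square)
    ultimately show "(v m + d - 2 * (\<Sum>y\<in>?X - {of_nat m}. 1 / (of_nat m - y)) * u m)
       / (poly (node_poly (?X - {of_nat m})) (of_nat m))\<^sup>2
      = C m * (v m + d - 2 * lam m * u m) / (fact n)\<^sup>2"
      by (simp only:)
  qed
  also have "\<dots> = (\<Sum>m\<le>n. C m * (v m - 2 * lam m * u m) + C m * d) / (fact n)\<^sup>2"
    unfolding sum_divide_distrib by (intro sum.cong) (auto simp: algebra_simps)
  also have "\<dots> = 0"
    unfolding sum.distrib sum_distrib_right[symmetric] d_def
    by (simp add: C_def)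
  finally have "coeff S (2 * n + 1) = 0" .
  then have "degree S \<noteq> 2 * n + 1" by (metis leading_coeff_0_iff degree_0 add_is_0 one_neq_zero)
  then have "degree S \<le> 2 * n" using S(1) by simp
  moreover have "poly S (of_nat m) = u m" "poly (pderiv S) (of_nat m) = v m + d" if "m \<le> n" for m
    using S(2,3)[of "of_nat m"] that by auto
  ultimately have "unit_interpolant n U V S"
    by (simp add: unit_interpolant_def u_def v_def del: of_nat_Suc)
  then show ?thesis using that by blast
qed

text \<open>The conditions fix \<open>Q\<close> only up to an additive constant. The normalised
  difference \<open>R\<close> vanishes at all nodes and its derivative takes one value there;
  \<open>hermite_functional\<close> forces this value to be zero, so \<open>R\<close> has too many
  double zeros.\<close>

lemma unit_interpolant_unique:
  assumes "unit_interpolant n U V Q" "unit_interpolant n U V S"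
  shows "pderiv Q = pderiv S"
proof -
  let ?X = "of_nat ` {..n} :: 'a set"
  define R where "R = Q - S - [:poly Q 0 - poly S 0:]"
  have degR: "degree R \<le> 2 * n" using assms
    unfolding R_def unit_interpolant_def by (intro degree_diff_le) auto
  have "\<forall>m<n. poly R (of_nat (Suc m)) - poly R (of_nat m) = 0"
    using assms by (simp add: R_def unit_interpolant_def algebra_simps)
  from poly_eq_partial_sum[where f = "\<lambda>m. poly R (of_nat m)", OF this]
  have R0: "poly R (of_nat m) = 0" if "m \<le> n" for m
    using that by (simp add: R_def)
  have pR: "pderiv R = pderiv Q - pderiv S" by (simp add: R_def pderiv_diff pderiv_pCons)
  have "\<forall>m<n. poly (pderiv R) (of_nat (Suc m)) - poly (pderiv R) (of_nat m) = 0"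
    using assms by (simp add: pR unit_interpolant_def algebra_simps)
  from poly_eq_partial_sum[where f = "\<lambda>m. poly (pderiv R) (of_nat m)", OF this]
  have R1: "poly (pderiv R) (of_nat m) = poly (pderiv R) 0" if "m \<le> n" for m
    using that by simp
  have "(\<Sum>m\<le>n. (of_nat (n choose m))\<^sup>2) * poly (pderiv R) 0 = 0"
    using hermite_functional[OF degR] R0 R1 by (simp add: sum_distrib_right)
  then have "poly (pderiv R) 0 = 0" by simp
  then have "R = 0" using degR R0 R1 by (intro hermite_unique[of ?X]) auto
  then show ?thesis using pR by simp
qed

section \<open>Signs of alternating binomial sums\<close>

lemma lagrange_coeff:
  fixes p :: "'a::field poly"
  assumes "finite X" "degree p < card X"
  shows "coeff p (card X - 1) = (\<Sum>x\<in>X. poly p x / poly (node_poly (X - {x})) x)"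
proof -
  define w where "w x = poly (node_poly (X - {x})) x" for x
  define L where "L = (\<Sum>x\<in>X. smult (poly p x / w x) (node_poly (X - {x})))"
  have w0: "w x \<noteq> 0" if "x \<in> X" for x
    using assms by (simp add: w_def poly_node_poly_eq_0_iff)
  have degN: "degree (node_poly (X - {x})) = card X - 1" if "x \<in> X" for x
    using assms(1) that by (simp add: card_Diff_singleton)
  have "degree L \<le> card X - 1"
    unfolding L_def using assms(1) degN
    by (intro degree_sum_le) (auto intro: order.trans[OF degree_smult_le])
  moreover have "poly L x = poly p x" if "x \<in> X" for x
  proof -
    have "poly L x = (\<Sum>y\<in>X. if y = x then poly p x else 0)"
      unfolding L_def poly_sum
    proof (intro sum.cong refl)
      fix y assume "y \<in> X"
      show "poly (smult (poly p y / w y) (node_poly (X - {y}))) x = (if y = x then poly p x else 0)"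
      proof (cases "y = x")
        case False
        then have "poly (node_poly (X - {y})) x = 0"
          using assms(1) that by (simp add: poly_node_poly_eq_0_iff)
        then show ?thesis using False by simp
      qed (use w0[OF that] in \<open>simp add: w_def\<close>)
    qed
    then show ?thesis using assms(1) that by simp
  qed
  ultimately have "p = L"
    using assms by (intro poly_eqI_degree[of X]) auto
  then have "coeff p (card X - 1) = coeff L (card X - 1)" by simp
  also have "\<dots> = (\<Sum>x\<in>X. poly p x / w x * coeff (node_poly (X - {x})) (card X - 1))"
    by (simp only: L_def coeff_sum coeff_smult)
  also have "\<dots> = (\<Sum>x\<in>X. poly p x / w x)"
  proof (intro sum.cong refl)
    fix x assume "x \<in> X"
    then show "poly p x / w x * coeff (node_poly (X - {x})) (card X - 1) = poly p x / w x"
      using degN[of x] lead_coeff_node_poly[of "X - {x}"] by simp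
  qed
  finally show ?thesis by (simp add: w_def)
qed

text \<open>Up to sign this is the \<open>n\<close>-th finite difference of \<open>p\<close> at 0.
  It is \<open>lagrange_coeff\<close> for the nodes 0, ..., n, whose weights are signed binomial
  coefficients over \<open>fact n\<close>.\<close>

lemma alternating_choose_poly_sum:
  fixes p :: "'a::field_char_0 poly"
  assumes "degree p \<le> n"
  shows "(\<Sum>j\<le>n. (- 1) ^ j * of_nat (n choose j) * poly p (of_nat j))
    = (- 1) ^ n * fact n * coeff p n"
proof -
  let ?X = "of_nat ` {..n} :: 'a set"
  have "coeff p n = (\<Sum>x\<in>?X. poly p x / poly (node_poly (?X - {x})) x)"
    using lagrange_coeff[of ?X p] assms by simp
  also have "\<dots> = (\<Sum>j\<le>n. poly p (of_nat j) / poly (node_poly (?X - {of_nat j})) (of_nat j))"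
    by (subst sum.reindex) auto
  also have "\<dots> = (\<Sum>j\<le>n. (- 1) ^ n / fact n * ((- 1) ^ j * of_nat (n choose j) * poly p (of_nat j)))"
  proof (intro sum.cong refl)
    fix j assume "j \<in> {..n}"
    then have j: "j \<le> n" by simp
    have sgn: "inverse ((- 1) ^ (n - j)) = ((- 1) ^ n * (- 1) ^ j :: 'a)"
      using j by (simp add: minus_one_power_iff)
    show "poly p (of_nat j) / poly (node_poly (?X - {of_nat j})) (of_nat j)
      = (- 1) ^ n / fact n * ((- 1) ^ j * of_nat (n choose j) * poly p (of_nat j))"
      using j sgn by (simp add: poly_node_poly_of_nat binomial_fact divide_inverse)
  qed
  finally have "coeff p n = (- 1) ^ n / fact n *
      (\<Sum>j\<le>n. (- 1) ^ j * of_nat (n choose j) * poly p (of_nat j))"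
    by (simp only: sum_distrib_left)
  then show ?thesis by (simp add: mult.assoc)
qed

section \<open>Logarithmic derivatives and factorial products\<close>

lemma poly_pderiv_prod:
  fixes f :: "'b \<Rightarrow> 'a::field poly"
  assumes "finite A" "\<And>k. k \<in> A \<Longrightarrow> poly (f k) x \<noteq> 0"
  shows "poly (pderiv (\<Prod>k\<in>A. f k)) x
    = (\<Prod>k\<in>A. poly (f k) x) * (\<Sum>k\<in>A. poly (pderiv (f k)) x / poly (f k) x)"
  using assms
  by (induction A rule: finite_induct) (auto simp: pderiv_mult pderiv_1 poly_prod field_simps)

lemma falling_factorial_fact:
  "m \<le> j \<Longrightarrow> (\<Prod>k<m. of_nat j - of_nat k :: 'a::field_char_0) = fact j / fact (j - m)"
proof (induction m)
  case (Suc m)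
  then have "j - m = Suc (j - Suc m)" by simp
  then have "fact (j - m) = (of_nat j - of_nat m :: 'a) * fact (j - Suc m)"
    using Suc.prems by (simp add: of_nat_diff)
  moreover have "of_nat j - of_nat m \<noteq> (0 :: 'a)" using Suc.prems by simp
  ultimately show ?case using Suc by simp
qed simp

lemma rising_factorial_fact:
  "m \<le> n \<Longrightarrow> (\<Prod>k\<in>{m<..n}. of_nat (c + k) :: 'a::field_char_0) = fact (c + n) / fact (c + m)"
proof (induction n rule: dec_induct)
  case (step n)
  then have "{m<..Suc n} = insert (Suc n) {m<..n}" by auto
  then show ?case using step by simp
qed simp

lemma sum_inverse_falling:
  "m \<le> n \<Longrightarrow> (\<Sum>k<m. 1 / (of_nat n - of_nat k :: 'a::real_normed_field)) = harm n - harm (n - m)"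
proof (induction m)
  case (Suc m)
  then have "n - m = Suc (n - Suc m)" by simp
  then have "harm (n - m) = harm (n - Suc m) + 1 / (of_nat n - of_nat m :: 'a)"
    using Suc.prems by (simp add: harm_Suc of_nat_diff inverse_eq_divide)
  then show ?case using Suc by simp
qed simp

lemma sum_inverse_rising:
  "m \<le> n \<Longrightarrow> (\<Sum>k\<in>{m<..n}. 1 / (of_nat k :: 'a::real_normed_field)) = harm n - harm m"
proof (induction n rule: dec_induct)
  case (step n)
  then have "{m<..Suc n} = insert (Suc n) {m<..n}" by auto
  then show ?case using step by (simp add: harm_Suc inverse_eq_divide del: of_nat_Suc)
qed simp

text \<open>
  A multiple of the well-poised sum ${}_2F_1(-y,-n;1-y+n;-1)$. Its value and its derivative at
  $y=n$ are the alternating sums that decide the signs of the fluxes; Kummer's theorem gives the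
  roots $1,3,\dots,2n-1$. Odd roots $j\le n$ come from the antisymmetry $m\mapsto j-m$ of the sum,
  the others from the reflection $y\mapsto 2n-y$.
\<close>

definition kummer_poly :: "nat \<Rightarrow> real poly" where
  "kummer_poly n = (\<Sum>m\<le>n. smult ((- 1) ^ m * of_nat (n choose m))
     ((\<Prod>k<m. [:- of_nat k, 1:]) * (\<Prod>k\<in>{m<..n}. [:of_nat (n + k), - 1:])))"

lemma poly_kummer_poly:
  "poly (kummer_poly n) y = (\<Sum>m\<le>n. (- 1) ^ m * of_nat (n choose m) *
     ((\<Prod>k<m. y - of_nat k) * (\<Prod>k\<in>{m<..n}. of_nat (n + k) - y)))"
  by (simp add: kummer_poly_def poly_sum poly_prod)

lemma degree_kummer_poly: "degree (kummer_poly n) \<le> n"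
  unfolding kummer_poly_def
proof (intro degree_sum_le order.trans[OF degree_smult_le] order.trans[OF degree_mult_le])
  fix m assume m: "m \<in> {..n}"
  have "degree (\<Prod>k<m. [:- of_nat k, 1 :: real:]) \<le> m"
    by (rule order.trans[OF degree_prod_sum_le]) auto
  moreover have "degree (\<Prod>k\<in>{m<..n}. [:of_nat (n + k), - 1 :: real:]) \<le> n - m"
    by (rule order.trans[OF degree_prod_sum_le]) auto
  ultimately show "degree (\<Prod>k<m. [:- of_nat k, 1 :: real:]) +
      degree (\<Prod>k\<in>{m<..n}. [:of_nat (n + k), - 1 :: real:]) \<le> n"
    using m by simp
qed auto

text \<open>Reversing the order of summation flips every sign because \<open>j\<close> is odd, so
  the sum equals its own negative.\<close>

lemma alternating_sum_reflect:
  fixes f :: "nat \<Rightarrow> 'a::field_char_0"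
  assumes "odd j" "\<And>m. m \<le> j \<Longrightarrow> f (j - m) = f m"
  shows "(\<Sum>m\<le>j. (- 1) ^ m * f m) = 0"
proof -
  have "(\<Sum>m\<le>j. (- 1) ^ m * f m) = (\<Sum>m\<le>j. (- 1) ^ (j - m) * f (j - m))"
    by (rule sum.nat_diff_reindex[symmetric, where n = "Suc j", unfolded lessThan_Suc_atMost diff_Suc_Suc])
  also have "\<dots> = - (\<Sum>m\<le>j. (- 1) ^ m * f m)"
    unfolding sum_negf[symmetric]
    using assms by (intro sum.cong) (auto simp: minus_one_power_iff)
  finally show ?thesis by (simp add: eq_neg_iff_add_eq_0 flip: mult_2)
qed

lemma kummer_poly_odd_root:
  assumes "odd j" "j \<le> n"
  shows "poly (kummer_poly n) (of_nat j) = 0"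
proof -
  have "poly (kummer_poly n) (of_nat j) = (\<Sum>m\<le>j. (- 1) ^ m * of_nat (n choose m) *
     ((\<Prod>k<m. of_nat j - of_nat k) * (\<Prod>k\<in>{m<..n}. of_nat (n + k) - of_nat j)))"
    \<comment> \<open>For \<open>m > j\<close> the falling product contains the zero factor
      \<open>k = j\<close>.\<close>
    unfolding poly_kummer_poly using assms(2) by (intro sum.mono_neutral_right) auto
  also have "\<dots> = (\<Sum>m\<le>j. fact j * fact (2 * n - j) / fact n *
      ((- 1) ^ m * (of_nat (n choose m) * of_nat (n choose (j - m)))))"
  proof (intro sum.cong refl)
    fix m assume "m \<in> {..j}"
    then have m: "m \<le> j" "m \<le> n" using assms by auto
    have "(\<Prod>k\<in>{m<..n}. of_nat (n + k) - of_nat j :: real) = (\<Prod>k\<in>{m<..n}. of_nat ((n - j) + k))"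
      using assms by (intro prod.cong) auto
    also have "\<dots> = fact (n - j + n) / fact (n - j + m)" by (rule rising_factorial_fact[OF m(2)])
    finally have "(\<Prod>k\<in>{m<..n}. of_nat (n + k) - of_nat j :: real) = fact (2 * n - j) / fact (n - (j - m))"
      using assms m by (simp add: mult_2)
    then show "(- 1) ^ m * of_nat (n choose m) *
        ((\<Prod>k<m. of_nat j - of_nat k) * (\<Prod>k\<in>{m<..n}. of_nat (n + k) - of_nat j))
      = fact j * fact (2 * n - j) / fact n *
        ((- 1) ^ m * (of_nat (n choose m) * of_nat (n choose (j - m))) :: real)"
      using assms m falling_factorial_fact[OF m(1), where 'a = real]
      by (simp add: binomial_fact[of "j - m" n])
  qed
  also have "\<dots> = 0"
    unfolding sum_distrib_left[symmetric]
    using alternating_sum_reflect[OF assms(1), of "\<lambda>m. of_nat (n choose m) * of_nat (n choose (j - m)) :: real"]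
    by (simp add: mult.commute)
  finally show ?thesis .
qed

text \<open>Replacing \<open>y\<close> by \<open>2n - y\<close> swaps the two products and turns
  term \<open>m\<close> into term \<open>n - m\<close>; the change of alternating sign leaves
  \<open>(- 1) ^ n\<close>.\<close>

lemma kummer_poly_reflect:
  "poly (kummer_poly n) (2 * of_nat n - y) = (- 1) ^ n * poly (kummer_poly n) y"
proof -
  define a where "a m z = (\<Prod>k<m. z - of_nat k :: real)" for m z
  define b where "b m z = (\<Prod>k\<in>{m<..n}. of_nat (n + k) - z :: real)" for m z
  have ab: "b m z = a (n - m) (2 * of_nat n - z)" if "m \<le> n" for m z
    unfolding a_def b_def using that
    by (intro prod.reindex_bij_witness[of _ "\<lambda>k. n - k" "\<lambda>k. n - k"]) (auto simp: of_nat_diff)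
  have "poly (kummer_poly n) (2 * of_nat n - y)
      = (\<Sum>m\<le>n. (- 1) ^ m * of_nat (n choose m) * (a m (2 * of_nat n - y) * b m (2 * of_nat n - y)))"
    by (simp add: poly_kummer_poly a_def b_def)
  also have "\<dots> = (\<Sum>m\<le>n. (- 1) ^ (n - m) * of_nat (n choose (n - m)) *
      (a (n - m) (2 * of_nat n - y) * b (n - m) (2 * of_nat n - y)))"
    by (rule sum.nat_diff_reindex[symmetric, where n = "Suc n", unfolded lessThan_Suc_atMost diff_Suc_Suc])
  also have "\<dots> = (\<Sum>m\<le>n. (- 1) ^ n * ((- 1) ^ m * of_nat (n choose m) * (a m y * b m y)))"
    using ab by (intro sum.cong refl)
      (auto simp: minus_one_power_iff binomial_symmetric[symmetric])
  also have "\<dots> = (- 1) ^ n * poly (kummer_poly n) y"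
    by (simp add: poly_kummer_poly a_def b_def sum_distrib_left)
  finally show ?thesis .
qed

lemma prod_uminus_lessThan:
  "(\<Prod>k<n. - f k) = (- 1) ^ n * (\<Prod>k<n. f k :: 'a::comm_ring_1)"
  by (induction n) (auto simp: algebra_simps)

text \<open>The \<open>n\<close> distinct roots exhaust the degree and leave a constant
  \<open>c\<close>. Its sign is read off at 0, where only the term \<open>m = 0\<close> survives:
  the value is positive while the node product has sign \<open>(- 1) ^ n\<close>.\<close>

lemma kummer_poly_factor:
  obtains c where "(- 1) ^ n * c > 0"
    "kummer_poly n = smult c (node_poly ((\<lambda>k. of_nat (2 * k + 1)) ` {..<n}))"
proof -
  let ?X = "(\<lambda>k. of_nat (2 * k + 1)) ` {..<n} :: real set"
  have card: "card ?X = n" by (subst card_image) (auto intro!: inj_onI)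
  have "poly (kummer_poly n) x = 0" if "x \<in> ?X" for x
  proof -
    obtain k where k: "k < n" "x = of_nat (2 * k + 1)" using \<open>x \<in> ?X\<close> by auto
    show ?thesis
    proof (cases "2 * k + 1 \<le> n")
      case True
      then show ?thesis using kummer_poly_odd_root[of "2 * k + 1" n] k by simp
    next
      case False
      \<comment> \<open>A root above \<open>n\<close> is the mirror image of \<open>?j\<close>, an
        odd number below \<open>n\<close>.\<close>
      let ?j = "2 * n - (2 * k + 1)"
      have "poly (kummer_poly n) (of_nat ?j) = 0"
        using False k by (intro kummer_poly_odd_root) auto
      moreover have "2 * of_nat n - x = of_nat ?j" using k by (simp add: of_nat_diff)
      ultimately show ?thesis using kummer_poly_reflect[of n x] by simp
    qed
  qed
  then have "node_poly ?X dvd kummer_poly n" by (intro node_poly_dvd) auto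
  then obtain R where R: "kummer_poly n = node_poly ?X * R" by (metis dvdE)
  have val: "poly (kummer_poly n) 0 = (\<Prod>k\<in>{0<..n}. of_nat (n + k))"
  proof -
    have "poly (kummer_poly n) 0 = (\<Sum>m\<in>{0}. (- 1) ^ m * of_nat (n choose m) *
      ((\<Prod>k<m. 0 - of_nat k) * (\<Prod>k\<in>{m<..n}. of_nat (n + k) - 0)))"
      unfolding poly_kummer_poly by (intro sum.mono_neutral_right) auto
    then show ?thesis by simp
  qed
  have pos: "poly (kummer_poly n) 0 > 0" unfolding val by (intro prod_pos) auto
  have "R \<noteq> 0" using pos R by auto
  then have "degree R = 0"
    using degree_kummer_poly[of n] card R by (simp add: degree_mult_eq)
  then obtain c where c: "R = [:c:]" by (rule degree_eq_zeroE)
  have "poly (node_poly ?X) 0 = (\<Prod>k<n. - of_nat (2 * k + 1))"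
    unfolding node_poly_def poly_prod by (subst prod.reindex) (auto intro!: inj_onI)
  also have "\<dots> = (- 1) ^ n * (\<Prod>k<n. of_nat (2 * k + 1))"
    by (rule prod_uminus_lessThan)
  finally have "poly (kummer_poly n) 0 = (- 1) ^ n * c * (\<Prod>k<n. of_nat (2 * k + 1))"
    by (simp add: R c)
  moreover have "(\<Prod>k<n. of_nat (2 * k + 1) :: real) > 0" by (intro prod_pos) auto
  ultimately have "(- 1) ^ n * c > 0" using pos by (metis zero_less_mult_pos2)
  then show ?thesis using that R c by (simp add: mult.commute)
qed

section \<open>Evaluation at \<open>y = n\<close> and the resulting signs\<close>

lemma poly_kummer_poly_self:
  "poly (kummer_poly n) (of_nat n) = fact n * (\<Sum>m\<le>n. (- 1) ^ m * (of_nat (n choose m))\<^sup>2)"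
  unfolding poly_kummer_poly sum_distrib_left
proof (intro sum.cong refl)
  fix m assume "m \<in> {..n}"
  then have m: "m \<le> n" by simp
  have "(\<Prod>k\<in>{m<..n}. of_nat (n + k) - of_nat n :: real) = fact n / fact m"
    using rising_factorial_fact[OF m, where c = 0 and 'a = real] by simp
  then show "(- 1) ^ m * of_nat (n choose m) * ((\<Prod>k<m. of_nat n - of_nat k) *
      (\<Prod>k\<in>{m<..n}. of_nat (n + k) - of_nat n))
    = (fact n * ((- 1) ^ m * (of_nat (n choose m))\<^sup>2) :: real)"
    using m falling_factorial_fact[OF m, where 'a = real]
    by (simp add: binomial_fact power2_eq_square mult_ac)
qed

text \<open>In term \<open>m\<close> the falling product has logarithmic derivative
  \<open>harm n - harm (n - m)\<close> and the rising one \<open>harm m - harm n\<close>; adding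
  them cancels \<open>harm n\<close>.\<close>

lemma poly_pderiv_kummer_poly_self:
  "poly (pderiv (kummer_poly n)) (of_nat n)
    = fact n * (\<Sum>m\<le>n. (- 1) ^ m * (of_nat (n choose m))\<^sup>2 * (harm m - harm (n - m)))"
  unfolding kummer_poly_def pderiv_sum poly_sum sum_distrib_left
proof (intro sum.cong refl)
  fix m assume "m \<in> {..n}"
  then have m: "m \<le> n" by simp
  let ?a = "\<Prod>k<m. [:- of_nat k, 1 :: real:]"
  let ?b = "\<Prod>k\<in>{m<..n}. [:of_nat (n + k), - 1 :: real:]"
  let ?x = "of_nat n :: real"
  have a: "poly ?a ?x = fact n / fact (n - m)"
    using falling_factorial_fact[OF m, where 'a = real] by (simp add: poly_prod)
  have b: "poly ?b ?x = fact n / fact m"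
    using rising_factorial_fact[OF m, where c = 0 and 'a = real] by (simp add: poly_prod)
  have "poly (pderiv ?a) ?x = poly ?a ?x * (\<Sum>k<m. 1 / (of_nat n - of_nat k))"
    using m by (subst poly_pderiv_prod) (auto simp: pderiv_pCons poly_prod)
  then have a': "poly (pderiv ?a) ?x = poly ?a ?x * (harm n - harm (n - m))"
    using sum_inverse_falling[OF m, where 'a = real] by simp
  have "poly (pderiv ?b) ?x = poly ?b ?x * - (\<Sum>k\<in>{m<..n}. 1 / of_nat k)"
    using m by (subst poly_pderiv_prod) (auto simp: pderiv_pCons poly_prod sum_negf)
  then have b': "poly (pderiv ?b) ?x = poly ?b ?x * (harm m - harm n)"
    using sum_inverse_rising[OF m, where 'a = real] by simp
  have "poly (pderiv (?a * ?b)) ?x = poly ?a ?x * poly ?b ?x * (harm m - harm (n - m))"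
    unfolding pderiv_mult poly_add poly_mult a' b' by (simp add: algebra_simps)
  also have "poly ?a ?x * poly ?b ?x = fact n * of_nat (n choose m)"
    unfolding a b using m by (simp add: binomial_fact)
  finally show "poly (pderiv (smult ((- 1) ^ m * of_nat (n choose m)) (?a * ?b))) ?x
    = fact n * ((- 1) ^ m * (of_nat (n choose m))\<^sup>2 * (harm m - harm (n - m)))"
    by (simp add: pderiv_smult power2_eq_square)
qed

text \<open>Up to a factorial this is the value of \<open>kummer_poly\<close> at
  \<open>2 * s\<close>. Exactly \<open>s\<close> of its roots 1, 3, ..., 4s - 1 lie above that
  point, and the constant factor is positive in even degree.\<close>

lemma alternating_choose_square_sign:
  "(- 1) ^ s * (\<Sum>m\<le>2 * s. (- 1) ^ m * (of_nat (2 * s choose m))\<^sup>2) > (0 :: real)"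
proof -
  let ?X = "(\<lambda>k. of_nat (2 * k + 1)) ` {..<2 * s} :: real set"
  obtain c where c: "(- 1) ^ (2 * s) * c > 0" "kummer_poly (2 * s) = smult c (node_poly ?X)"
    by (rule kummer_poly_factor)
  let ?f = "\<lambda>k. of_nat (2 * s) - of_nat (2 * k + 1) :: real"
  have "poly (node_poly ?X) (of_nat (2 * s)) = (\<Prod>k<2 * s. ?f k)"
    unfolding node_poly_def poly_prod by (subst prod.reindex) (auto intro!: inj_onI)
  also have "\<dots> = (\<Prod>k\<in>{0..<s}. ?f k) * (\<Prod>k\<in>{s..<2 * s}. ?f k)"
    by (simp add: lessThan_atLeast0 prod.atLeastLessThan_concat)
  also have "(\<Prod>k\<in>{s..<2 * s}. ?f k) = (\<Prod>k<s. - of_nat (2 * k + 1))"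
    by (rule prod.reindex_bij_witness[of _ "\<lambda>k. k + s" "\<lambda>k. k - s"]) (auto simp: of_nat_diff)
  also have "\<dots> = (- 1) ^ s * (\<Prod>k<s. of_nat (2 * k + 1))"
    by (rule prod_uminus_lessThan)
  finally have val: "poly (kummer_poly (2 * s)) (of_nat (2 * s))
      = (- 1) ^ s * (c * (\<Prod>k\<in>{0..<s}. ?f k) * (\<Prod>k<s. of_nat (2 * k + 1)))"
    using c by simp
  have "(\<Prod>k\<in>{0..<s}. ?f k) > 0" by (intro prod_pos) auto
  moreover have "(\<Prod>k<s. of_nat (2 * k + 1) :: real) > 0" by (intro prod_pos) auto
  ultimately have "c * (\<Prod>k\<in>{0..<s}. ?f k) * (\<Prod>k<s. of_nat (2 * k + 1)) > 0"
    using c(1) by (intro mult_pos_pos) auto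
  then have "(- 1) ^ s * poly (kummer_poly (2 * s)) (of_nat (2 * s)) > 0"
    unfolding val by simp
  then have "0 < fact (2 * s) * ((- 1) ^ s * (\<Sum>m\<le>2 * s. (- 1) ^ m * (of_nat (2 * s choose m))\<^sup>2 :: real))"
    unfolding poly_kummer_poly_self by (simp add: mult.left_commute)
  then show ?thesis by (rule zero_less_mult_pos) simp
qed

text \<open>Here \<open>2 * s + 1\<close> is itself a root, so the derivative is the constant factor
  times the differences to the other roots. Of these \<open>s\<close> are negative, and the constant
  is negative in odd degree.\<close>

lemma alternating_choose_square_harm_sign:
  "(- 1) ^ s * (\<Sum>m\<le>2 * s + 1. (- 1) ^ m * (of_nat (2 * s + 1 choose m))\<^sup>2 *
     (harm m - harm (2 * s + 1 - m))) < (0 :: real)"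
proof -
  let ?n = "2 * s + 1"
  let ?X = "(\<lambda>k. of_nat (2 * k + 1)) ` {..<?n} :: real set"
  obtain c where c: "(- 1) ^ ?n * c > 0" "kummer_poly ?n = smult c (node_poly ?X)"
    by (rule kummer_poly_factor)
  have "of_nat ?n \<in> ?X" by (rule image_eqI[of _ _ s]) auto
  then have "poly (pderiv (node_poly ?X)) (of_nat ?n) = poly (node_poly (?X - {of_nat ?n})) (of_nat ?n)"
    by (intro poly_pderiv_node_poly_at_node) auto
  also have "?X - {of_nat ?n} = (\<lambda>k. of_nat (2 * k + 1)) ` ({..2 * s} - {s})"
    by (auto simp: less_Suc_eq_le)
  also have "poly (node_poly \<dots>) (of_nat ?n) = (\<Prod>k\<in>{..2 * s} - {s}. of_nat ?n - of_nat (2 * k + 1))"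
    unfolding node_poly_def poly_prod by (subst prod.reindex) (auto intro!: inj_onI)
  also have "\<dots> = (\<Prod>k\<in>{..2 * s} - {s}. 2 * (of_nat s - of_nat k))"
    by (intro prod.cong) auto
  also have "\<dots> = 2 ^ (2 * s) * ((- 1) ^ s * fact s * fact s)"
    unfolding prod.distrib using prod_node_differences[of s "2 * s", where 'a = real] by simp
  finally have "poly (pderiv (kummer_poly ?n)) (of_nat ?n) = (- 1) ^ s * (c * (2 ^ (2 * s) * fact s * fact s))"
    using c(2) by (simp add: pderiv_smult)
  then have "(- 1) ^ s * poly (pderiv (kummer_poly ?n)) (of_nat ?n) = c * (2 ^ (2 * s) * fact s * fact s)"
    by simp
  also have "\<dots> < 0" using c(1) by (intro mult_neg_pos) auto
  finally have "fact ?n * ((- 1) ^ s * (\<Sum>m\<le>?n. (- 1) ^ m * (of_nat (?n choose m))\<^sup>2 *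
     (harm m - harm (?n - m)))) < (0 :: real)"
    unfolding poly_pderiv_kummer_poly_self by (simp only: mult.left_commute)
  then show ?thesis by (rule mult_less_cancel_left_pos[THEN iffD1, rotated, of _ _ 0, simplified]) simp
qed

text \<open>Pascal's rule splits the second binomial coefficient. The mixed products
  \<open>f i\<close> are symmetric under \<open>i\<close> to \<open>N - i\<close> with
  \<open>N\<close> odd, so their alternating sum vanishes.\<close>

lemma alternating_choose_mixed_sum:
  "(\<Sum>j\<le>2 * s. (- 1) ^ j * of_nat (2 * s choose j) * of_nat (2 * s + 1 choose j))
    = (\<Sum>j\<le>2 * s. (- 1) ^ j * (of_nat (2 * s choose j))\<^sup>2 :: 'a::field_char_0)"
proof (cases s)
  case (Suc r)
  define N where "N = 2 * r + 1"
  have N: "2 * s = Suc N" "odd N" by (simp_all add: N_def Suc)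
  define f where "f i = (of_nat (Suc N choose i) * of_nat (Suc N choose Suc i) :: 'a)" for i
  have split: "(of_nat (Suc (Suc N) choose Suc i) :: 'a) = of_nat (Suc N choose i) + of_nat (Suc N choose Suc i)" for i
    by simp
  have "(\<Sum>j\<le>Suc N. (- 1) ^ j * of_nat (Suc N choose j) * of_nat (Suc (Suc N) choose j) :: 'a)
      = 1 + (\<Sum>i\<le>N. (- 1) ^ Suc i * of_nat (Suc N choose Suc i) * of_nat (Suc (Suc N) choose Suc i))"
    by (subst sum.atMost_Suc_shift) simp
  also have "(\<Sum>i\<le>N. (- 1) ^ Suc i * of_nat (Suc N choose Suc i) * of_nat (Suc (Suc N) choose Suc i))
      = (\<Sum>i\<le>N. (- 1) ^ Suc i * (of_nat (Suc N choose Suc i))\<^sup>2) - (\<Sum>i\<le>N. (- 1) ^ i * f i)"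
    unfolding split f_def sum_subtractf[symmetric]
    by (intro sum.cong refl) (simp add: algebra_simps power2_eq_square del: binomial_Suc_Suc)
  also have "(\<Sum>i\<le>N. (- 1) ^ i * f i) = 0"
  proof (rule alternating_sum_reflect[OF N(2)])
    fix m assume "m \<le> N"
    then show "f (N - m) = f m"
      unfolding f_def using binomial_symmetric[of "Suc m" "Suc N"] binomial_symmetric[of m "Suc N"]
      by (simp add: Suc_diff_le mult.commute del: binomial_Suc_Suc)
  qed
  also have "1 + ((\<Sum>i\<le>N. (- 1) ^ Suc i * (of_nat (Suc N choose Suc i))\<^sup>2) - 0)
      = (\<Sum>j\<le>Suc N. (- 1) ^ j * (of_nat (Suc N choose j))\<^sup>2 :: 'a)"
    by (subst sum.atMost_Suc_shift[of _ N]) simp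
  finally show ?thesis using N by simp
qed simp

section \<open>Fluxes of the alternating modes\<close>

lemma sum_alternating: "(\<Sum>i<m. (- 1) ^ i) = (1 - (- 1) ^ m) / (2 :: 'a::field_char_0)"
  by (induction m) (auto simp: field_simps)

text \<open>The derivative of \<open>Q\<close> takes a single value \<open>A\<close> at all nodes,
  and \<open>hermite_functional\<close> solves for it. The exponent \<open>l + 1 + m\<close> has the
  parity of the cell offset \<open>m + 1 - l\<close>, where offset 0 is the cell ending at the flux
  face.\<close>

lemma flux_F_sign:
  fixes Q :: "complex poly"
  assumes Q: "unit_interpolant (2 * s + 1) (\<lambda>m. (- 1) ^ (l + 1 + m)) (\<lambda>_. 0) Q" and l: "l = s + 2"
    and k: "k \<le> 2 * s + 1"
  shows "Re (poly (pderiv Q) (of_nat k)) < 0"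
proof -
  let ?n = "2 * s + 1"
  define T where "T = (\<Sum>m\<le>?n. (- 1) ^ m * (of_nat (?n choose m))\<^sup>2 * (harm m - harm (?n - m)) :: real)"
  define C where "C = (\<Sum>m\<le>?n. (of_nat (?n choose m))\<^sup>2 :: real)"
  define A where "A = poly (pderiv Q) 0"
  \<comment> \<open>Subtracting the mean of the two values that \<open>Q\<close> takes at the nodes
    leaves values that only alternate in sign.\<close>
  define R where "R = Q - [:poly Q 0 + (- 1) ^ (l + 1) / 2:]"
  have pR: "pderiv R = pderiv Q" by (simp add: R_def pderiv_diff pderiv_pCons)
  have A: "poly (pderiv Q) (of_nat m) = A" if "m \<le> ?n" for m
    using poly_eq_partial_sum[where f = "\<lambda>m. poly (pderiv Q) (of_nat m)" and U = "\<lambda>_. 0", OF _ that] Q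
    by (simp add: unit_interpolant_def A_def)
  have R: "poly R (of_nat m) = - ((- 1) ^ (l + 1) * (- 1) ^ m / 2)" if "m \<le> ?n" for m
    using poly_eq_partial_sum[where f = "\<lambda>m. poly Q (of_nat m)" and U = "\<lambda>m. (- 1) ^ (l + 1 + m)", OF _ that] Q
    unfolding unit_interpolant_def power_add[of _ "l + 1"] sum_distrib_left[symmetric] sum_alternating
    by (simp add: R_def field_simps)
  have "degree R \<le> 2 * ?n" using Q unfolding R_def unit_interpolant_def
    by (intro degree_diff_le) auto
  from hermite_functional[OF this]
  have "0 = (\<Sum>m\<le>?n. (of_nat (?n choose m))\<^sup>2 *
      (poly (pderiv R) (of_nat m) - 2 * (harm m - harm (?n - m)) * poly R (of_nat m)))"
    by simp
  also have "\<dots> = (\<Sum>m\<le>?n. (of_nat (?n choose m))\<^sup>2 * A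
      + (- 1) ^ (l + 1) * ((- 1) ^ m * (of_nat (?n choose m))\<^sup>2 * (harm m - harm (?n - m))))"
    by (intro sum.cong refl) (simp add: A R pR algebra_simps)
  also have "\<dots> = of_real C * A + (- 1) ^ (l + 1) * of_real T"
    unfolding sum.distrib sum_distrib_right[symmetric] sum_distrib_left[symmetric]
    by (simp add: C_def T_def of_real_harm del: sum.atMost_Suc)
  finally have "of_real C * A = of_real ((- 1) ^ s * T)" by (simp add: l)
  then have "C * Re A = (- 1) ^ s * T" by (simp add: complex_eq_iff)
  then have "C * Re A < 0"
    using alternating_choose_square_harm_sign[of s] by (simp add: T_def)
  moreover have "C \<ge> 0" unfolding C_def by (intro sum_nonneg) auto
  ultimately have "Re A < 0" by (simp add: mult_less_0_iff)
  then show ?thesis using A[OF k] by simp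
qed

text \<open>Symmetry gives the second derivative at the middle node \<open>s + 1\<close>, and one
  step of a shift relation carries it to \<open>l\<close>. The result is twice the leading
  coefficient of \<open>S\<close> times a positive factor, and that coefficient is negative.\<close>

lemma flux_H_sign:
  fixes Q :: "complex poly"
  assumes Q: "unit_interpolant (2 * s + 1) (\<lambda>_. 0) (\<lambda>m. (- 1) ^ (l + 1 + m)) Q" and l: "l = s + 2"
    and s: "s \<ge> 1"
  shows "Re (poly (pderiv (pderiv Q)) (of_nat l)) < 0"
proof -
  let ?n = "2 * s + 1"
  let ?X = "of_nat ` {..?n} :: complex set"
  let ?Y = "of_nat ` {..2 * s} :: complex set"
  define sg where "sg = (\<Sum>m\<le>2 * s. (- 1) ^ m * (of_nat (2 * s choose m))\<^sup>2 :: real)"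
  define e :: complex where "e = (- 1) ^ (l + 1)"
  define S where "S = Q - [:poly Q 0:]"
  define d where "d = poly (pderiv Q) 0 + e / 2"
  have pS: "pderiv S = pderiv Q" by (simp add: S_def pderiv_diff pderiv_pCons)
  have degS: "degree S \<le> 2 * ?n" using Q unfolding S_def unit_interpolant_def
    by (intro degree_diff_le) auto
  have S0: "poly S (of_nat m) = 0" if "m \<le> ?n" for m
    using poly_eq_partial_sum[where f = "\<lambda>m. poly Q (of_nat m)" and U = "\<lambda>_. 0", OF _ that] Q
    by (simp add: unit_interpolant_def S_def)
  have S1: "poly (pderiv S) (of_nat m) = d - e * (- 1) ^ m / 2" if "m \<le> ?n" for m
    using poly_eq_partial_sum[where f = "\<lambda>m. poly (pderiv Q) (of_nat m)" and U = "\<lambda>m. (- 1) ^ (l + 1 + m)", OF _ that] Q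
    unfolding unit_interpolant_def power_add[of _ "l + 1"] sum_distrib_left[symmetric] sum_alternating
    by (simp add: pS d_def e_def field_simps)
  \<comment> \<open>As \<open>S\<close> vanishes at the nodes, \<open>hermite_functional\<close>
    involves only derivatives. The alternating part cancels for odd \<open>?n\<close>, which leaves
    the mean \<open>d\<close> times a nonzero sum.\<close>
  have "(\<Sum>m\<le>?n. (- 1) ^ m * (of_nat (?n choose m))\<^sup>2) = (0 :: complex)"
    by (rule alternating_sum_reflect) (auto simp: binomial_symmetric[symmetric])
  moreover have "(\<Sum>m\<le>?n. (of_nat (?n choose m))\<^sup>2 * d - e / 2 * ((- 1) ^ m * (of_nat (?n choose m))\<^sup>2))
      = (\<Sum>m\<le>?n. (of_nat (?n choose m))\<^sup>2 *
          (poly (pderiv S) (of_nat m) - 2 * (harm m - harm (?n - m)) * poly S (of_nat m)))"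
    by (intro sum.cong refl) (simp add: S0 S1 algebra_simps)
  ultimately have "d = 0"
    unfolding hermite_functional[OF degS] sum_subtractf sum_distrib_right[symmetric] sum_distrib_left[symmetric]
    using sum_choose_square_ne_0[of ?n, where 'a = complex] by auto
  with S1 have S1: "poly (pderiv S) (of_nat m) = - (e * (- 1) ^ m / 2)" if "m \<le> ?n" for m
    using that by simp

  have "node_poly ?X dvd S" using S0 by (intro node_poly_dvd) auto
  then obtain R where R: "S = node_poly ?X * R" by (metis dvdE)
  have e0: "e \<noteq> 0" by (simp add: e_def)
  have "S \<noteq> 0" using S1[of 0] e0 by auto
  then have R0: "R \<noteq> 0" using R by auto
  have "degree S = ?n + 1 + degree R" using R R0 by (simp add: degree_mult_eq)
  then have degR: "degree R \<le> 2 * s" using degS by simp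
  \<comment> \<open>At a node, the derivative of \<open>S\<close> is that of the node polynomial
    times \<open>R\<close>. For odd \<open>?n\<close> the alternating signs on the two sides
    cancel.\<close>
  have valR: "poly R (of_nat m) = e / (2 * fact ?n) * of_nat (?n choose m)" if m: "m \<le> ?n" for m
  proof -
    have "poly (node_poly ?X) (of_nat m) = 0" using m by (simp add: poly_node_poly_eq_0_iff)
    then have "(- 1) ^ (?n - m) * fact m * fact (?n - m) * poly R (of_nat m) = - (e * (- 1) ^ m / 2)"
      using S1[OF m] poly_pderiv_node_poly_of_nat[OF m, where 'a = complex]
      by (simp add: R pderiv_mult mult_ac)
    moreover have "(- 1) ^ (?n - m) = (- ((- 1) ^ m) :: complex)"
      using m by (simp add: minus_one_power_iff)
    ultimately have "(- 1) ^ m * (fact m * fact (?n - m) * poly R (of_nat m)) = (- 1) ^ m * (e / 2)"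
      by (simp add: mult_ac)
    then have "poly R (of_nat m) * (fact m * fact (?n - m)) = e / 2" by (simp add: mult_ac)
    then have "poly R (of_nat m) = e / 2 / (fact m * fact (?n - m))"
      by (rule nonzero_eq_divide_eq[THEN iffD2, rotated]) simp
    then show ?thesis using m by (simp add: binomial_fact del: fact_Suc)
  qed
  \<comment> \<open>The finite difference of order \<open>2 * s\<close> extracts the top coefficient
    of \<open>R\<close>, hence the leading coefficient of \<open>S\<close>.\<close>
  have "fact (2 * s) * coeff R (2 * s) = (\<Sum>j\<le>2 * s. (- 1) ^ j * of_nat (2 * s choose j) * poly R (of_nat j))"
    using alternating_choose_poly_sum[OF degR] by simp
  also have "\<dots> = e / (2 * fact ?n) *
      (\<Sum>j\<le>2 * s. (- 1) ^ j * of_nat (2 * s choose j) * of_nat (?n choose j))"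
    unfolding sum_distrib_left using valR by (intro sum.cong) (auto simp: mult_ac)
  also have "\<dots> = e / (2 * fact ?n) * of_real sg"
    unfolding alternating_choose_mixed_sum by (simp add: sg_def)
  finally have cR: "coeff R (2 * s) = e * of_real sg / (2 * fact ?n * fact (2 * s))"
    by (simp add: field_simps del: fact_Suc)
  have sg: "(- 1) ^ s * sg > 0" using alternating_choose_square_sign[of s] by (simp add: sg_def)
  then have "coeff R (2 * s) \<noteq> 0" using e0 unfolding cR by (auto simp del: fact_Suc)
  then have "degree R = 2 * s" using degR by (simp add: le_antisym le_degree)
  then have degS: "degree S = 2 * ?n" using \<open>degree S = ?n + 1 + degree R\<close> by simp
  have "lead_coeff S = lead_coeff R"
    unfolding R lead_coeff_mult lead_coeff_node_poly by simp
  then have lcS: "lead_coeff S = coeff R (2 * s)" unfolding \<open>degree R = 2 * s\<close> .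

  \<comment> \<open>At the nodes \<open>S\<close> vanishes and \<open>S'\<close> alternates, so \<open>S(x + 1) + S(x)\<close> has double zeros at
    \<open>0, \<dots>, n - 1\<close>, which determines it up to the factor \<open>kp\<close>.\<close>
  define W where "W = pcompose S [:1, 1:] + S"
  \<comment> \<open>The factor 2 arises because both summands of \<open>W\<close> have the leading
    coefficient of \<open>S\<close>.\<close>
  define kp where "kp = 2 * coeff R (2 * s)"
  have kp: "kp = of_real ((- 1) ^ (s + 1) * sg / (fact ?n * fact (2 * s)))"
    unfolding kp_def cR e_def l by simp
  have cW: "coeff W (2 * ?n) = kp"
    using lead_coeff_comp[of "[:1, 1:]" S] lcS by (simp add: W_def kp_def degS degree_pcompose)
  have degW: "degree W \<le> 2 * ?n" unfolding W_def using degS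
    by (intro degree_add_le) (auto simp: degree_pcompose)
  have shift: "poly (pcompose p [:1, 1:]) (of_nat m) = poly p (of_nat (Suc m))" for p :: "complex poly" and m
    by (simp add: poly_pcompose)
  have pshift: "pderiv (pcompose p [:1, 1:]) = pcompose (pderiv p) [:1, 1:]" for p :: "complex poly"
    by (simp add: pderiv_pcompose pderiv_pCons)
  have "(node_poly ?Y)\<^sup>2 dvd W"
  proof (rule node_poly_square_dvd)
    fix x assume "x \<in> ?Y"
    then obtain m where m: "m \<le> 2 * s" "x = of_nat m" by auto
    show "poly W x = 0" unfolding W_def m(2) poly_add shift using m by (simp add: S0 del: of_nat_Suc)
    show "poly (pderiv W) x = 0" unfolding W_def m(2) pderiv_add poly_add pshift shift
      using m by (simp add: S1 del: of_nat_Suc)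
  qed auto
  then obtain K where K: "W = (node_poly ?Y)\<^sup>2 * K" by (metis dvdE)
  have "kp \<noteq> 0" using \<open>coeff R (2 * s) \<noteq> 0\<close> by (simp add: kp_def)
  then have "W \<noteq> 0" using cW by auto
  then have "K \<noteq> 0" "node_poly ?Y \<noteq> 0" using K by auto
  then have "degree W = 2 * ?n + degree K"
    unfolding K by (simp add: degree_mult_eq degree_power_eq)
  then have "degree K = 0" using degW by simp
  then obtain c where c: "K = [:c:]" by (rule degree_eq_zeroE)
  have "lead_coeff W = lead_coeff K"
    unfolding K lead_coeff_mult lead_coeff_power lead_coeff_node_poly by simp
  moreover have "degree W = 2 * ?n" using \<open>degree W = 2 * ?n + degree K\<close> c by simp
  ultimately have "coeff W (2 * ?n) = c" by (simp only: c) simp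
  then have "kp = c" using cW by metis
  then have Wv: "W = smult kp ((node_poly ?Y)\<^sup>2)" using K c by simp
  \<comment> \<open>At a double zero of \<open>W\<close>, only the squared derivative of the node
    polynomial survives in the second derivative.\<close>
  have W2: "poly (pderiv (pderiv S)) (of_nat (Suc m)) + poly (pderiv (pderiv S)) (of_nat m)
      = 2 * kp * (fact m * fact (2 * s - m))\<^sup>2" if m: "m \<le> 2 * s" for m
  proof -
    have "poly (node_poly ?Y) (of_nat m) = 0" using m by (simp add: poly_node_poly_eq_0_iff)
    then have "poly (pderiv (pderiv W)) (of_nat m) = 2 * kp * (poly (pderiv (node_poly ?Y)) (of_nat m))\<^sup>2"
      by (simp add: Wv power2_eq_square pderiv_smult pderiv_mult pderiv_add)
    also have "\<dots> = 2 * kp * (fact m * fact (2 * s - m))\<^sup>2"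
      using m by (simp add: poly_pderiv_node_poly_of_nat power2_eq_square)
    finally show ?thesis unfolding W_def pderiv_add poly_add pshift shift .
  qed

  \<comment> \<open>Symmetry about \<open>n / 2\<close> gives \<open>S''(s) = S''(s + 1)\<close>, which starts the recursion \<open>W2\<close>.\<close>
  have "pcompose S [:of_nat ?n, - 1:] - S = 0"
  proof (rule hermite_unique[of ?X])
    have "degree (pcompose S [:of_nat ?n, - 1:] - S) \<le> 2 * ?n"
      using degS by (intro degree_diff_le) (auto simp: degree_pcompose)
    then show "degree (pcompose S [:of_nat ?n, - 1:] - S) < 2 * card ?X" by simp
  next
    fix x assume "x \<in> ?X"
    then obtain m where m: "m \<le> ?n" "x = of_nat m" by auto
    then have x: "of_nat ?n - x = of_nat (?n - m)" by (simp add: of_nat_diff)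
    show "poly (pcompose S [:of_nat ?n, - 1:] - S) x = 0"
      using x m S0[of m] S0[of "?n - m"] by (simp add: poly_pcompose)
    show "poly (pderiv (pcompose S [:of_nat ?n, - 1:] - S)) x = 0"
      using x m S1[of m] S1[of "?n - m"]
      by (simp add: poly_pcompose pderiv_pcompose pderiv_diff pderiv_pCons minus_one_power_iff)
  qed auto
  then have sym: "pcompose S [:of_nat ?n, - 1:] = S" by simp
  have "pderiv (pderiv (pcompose S [:of_nat ?n, - 1:])) = pcompose (pderiv (pderiv S)) [:of_nat ?n, - 1:]"
    by (simp add: pderiv_pcompose pderiv_pCons pderiv_minus)
  then have "poly (pderiv (pderiv S)) (of_nat s) = poly (pcompose (pderiv (pderiv S)) [:of_nat ?n, - 1:]) (of_nat s)"
    unfolding sym by (rule arg_cong)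
  then have mid: "poly (pderiv (pderiv S)) (of_nat (Suc s)) = poly (pderiv (pderiv S)) (of_nat s)"
    by (simp add: poly_pcompose add.commute)
  have "2 * poly (pderiv (pderiv S)) (of_nat (Suc s)) = 2 * (kp * (fact s * fact s)\<^sup>2)"
    using W2[of s] unfolding mid by simp
  then have S2: "poly (pderiv (pderiv S)) (of_nat (Suc s)) = kp * (fact s * fact s)\<^sup>2"
    by (rule mult_left_cancel[THEN iffD1, rotated]) simp
  \<comment> \<open>\<open>W2\<close> at \<open>s + 1\<close> links the known node to
    \<open>l\<close>; it applies because \<open>s \<ge> 1\<close> gives
    \<open>s + 1 \<le> 2 * s\<close>.\<close>
  have "Suc (Suc s) = l" "2 * s - Suc s = s - 1" using l by auto
  then have "poly (pderiv (pderiv S)) (of_nat l) + poly (pderiv (pderiv S)) (of_nat (Suc s))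
      = 2 * kp * (fact (Suc s) * fact (s - 1))\<^sup>2"
    using W2[of "Suc s"] s by (simp del: of_nat_Suc fact_Suc)
  then have "poly (pderiv (pderiv S)) (of_nat l)
      = kp * (2 * (fact (Suc s) * fact (s - 1))\<^sup>2 - (fact s * fact s)\<^sup>2)"
    unfolding S2 eq_diff_eq[symmetric] by (simp only: right_diff_distrib mult_ac)
  also have "\<dots> = of_real (- ((- 1) ^ s * sg) / (fact ?n * fact (2 * s)) *
      (2 * (fact (Suc s) * fact (s - 1))\<^sup>2 - (fact s * fact s)\<^sup>2))"
    unfolding kp by (simp del: fact_Suc)
  finally have D: "Re (poly (pderiv (pderiv Q)) (of_nat l)) = - ((- 1) ^ s * sg) / (fact ?n * fact (2 * s)) *
      (2 * (fact (Suc s) * fact (s - 1))\<^sup>2 - (fact s * fact s)\<^sup>2)"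
    by (simp only: pS Re_complex_of_real)
  obtain r where r: "s = Suc r" using s by (cases s) auto
  \<comment> \<open>The right side is (s + 1) / s times the left, so the bracket in \<open>D\<close>
    is positive.\<close>
  have "fact s * fact s \<le> (fact (Suc s) * fact (s - 1) :: real)"
    by (simp add: r algebra_simps)
  then have "(fact s * fact s)\<^sup>2 \<le> (fact (Suc s) * fact (s - 1) :: real)\<^sup>2"
    by (intro power_mono) auto
  moreover have "(fact (Suc s) * fact (s - 1) :: real)\<^sup>2 > 0" by simp
  ultimately have "2 * (fact (Suc s) * fact (s - 1))\<^sup>2 - (fact s * fact s :: real)\<^sup>2 > 0" by linarith
  moreover have "- ((- 1) ^ s * sg) / (fact ?n * fact (2 * s)) < 0"
    using sg by (intro divide_neg_pos) auto
  ultimately show ?thesis unfolding D by (rule mult_neg_pos[rotated])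
qed

section \<open>Reduction of the scheme to the unit grid\<close>

lemma has_vector_derivative_vec_iff:
  fixes w :: "real \<Rightarrow> 'a::real_normed_vector ^ 'n"
  shows "(w has_vector_derivative D) (at s)
    \<longleftrightarrow> (\<forall>i. ((\<lambda>x. w x $ i) has_vector_derivative D $ i) (at s))"
proof (intro iffI allI)
  fix i
  assume "(w has_vector_derivative D) (at s)"
  then show "((\<lambda>x. w x $ i) has_vector_derivative D $ i) (at s)"
    by (rule bounded_linear.has_vector_derivative[OF bounded_linear_vec_nth])
next
  assume *: "\<forall>i. ((\<lambda>x. w x $ i) has_vector_derivative D $ i) (at s)"
  show "(w has_vector_derivative D) (at s)"
    unfolding has_vector_derivative_def has_derivative_at_within
  proof (intro conjI vec_tendstoI)
    show "bounded_linear (\<lambda>x. x *\<^sub>R D)" by (rule bounded_linear_scaleR_left)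
    fix i
    have "((\<lambda>y. ((w y $ i - w s $ i) - (y - s) *\<^sub>R D $ i) /\<^sub>R norm (y - s)) \<longlongrightarrow> 0) (at s)"
      using * by (simp add: has_vector_derivative_def has_derivative_at_within)
    then show "((\<lambda>y. ((w y - w s - (y - s) *\<^sub>R D) /\<^sub>R norm (y - s)) $ i) \<longlongrightarrow> 0 $ i) (at s)"
      by simp
  qed
qed

lemma eigenvalue_of_det:
  fixes M :: "complex^2^2"
  assumes "(M $ 1 $ 1 - \<mu>) * (M $ 2 $ 2 - \<mu>) = M $ 1 $ 2 * M $ 2 $ 1"
  shows "eigenvalue_of M \<mu>"
proof -
  define N where "N = M - mat \<mu>"
  have N: "N $ 1 $ 1 = M $ 1 $ 1 - \<mu>" "N $ 2 $ 2 = M $ 2 $ 2 - \<mu>"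
    "N $ 1 $ 2 = M $ 1 $ 2" "N $ 2 $ 1 = M $ 2 $ 1"
    by (simp_all add: N_def mat_def)
  have "det N = 0" using assms by (simp add: det_2 N)
  then have "\<not> invertible N" by (simp add: invertible_det_nz)
  then obtain z where z: "N *v z = 0" "z \<noteq> 0"
    using matrix_left_invertible_ker[of N] invertible_left_inverse[of N] by auto
  have "M *v z = \<mu> *s z"
    using z(1) by (simp add: vec_eq_iff forall_2 matrix_vector_mult_def sum_2 N algebra_simps)
  then show ?thesis using z(2) by (auto simp: eigenvalue_of_def)
qed

text \<open>The principal square root has nonnegative real part, so the root of the characteristic
  polynomial with the minus sign has real part at most half that of the trace.\<close>

lemma eigenvalue_of_trace_neg:
  fixes M :: "complex^2^2"
  assumes "Re (M $ 1 $ 1 + M $ 2 $ 2) < 0"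
  shows "\<exists>\<mu>. eigenvalue_of M \<mu> \<and> Re \<mu> < 0"
proof -
  define tr where "tr = M $ 1 $ 1 + M $ 2 $ 2"
  define r where "r = csqrt (tr\<^sup>2 - 4 * (M $ 1 $ 1 * M $ 2 $ 2 - M $ 1 $ 2 * M $ 2 $ 1))"
  define \<mu> where "\<mu> = (tr - r) / 2"
  have r: "r * r = tr * tr - 4 * (M $ 1 $ 1 * M $ 2 $ 2 - M $ 1 $ 2 * M $ 2 $ 1)"
    using power2_csqrt by (simp add: r_def flip: power2_eq_square)
  have "4 * ((M $ 1 $ 1 - \<mu>) * (M $ 2 $ 2 - \<mu>)) = 4 * (M $ 1 $ 2 * M $ 2 $ 1)"
    using r by (simp add: \<mu>_def tr_def field_simps)
  then have "eigenvalue_of M \<mu>" by (intro eigenvalue_of_det) simp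
  moreover have "Re r \<ge> 0" unfolding r_def by (rule Re_csqrt)
  then have "Re \<mu> < 0" using assms by (simp add: \<mu>_def tr_def)
  ultimately show ?thesis by blast
qed

section \<open>Cell averages and the affine change to the unit grid\<close>

lemma poly_antiderivative:
  fixes p :: "'a::field_char_0 poly"
  obtains Q where "pderiv Q = p"
proof -
  define Q where "Q = (\<Sum>i\<le>degree p. monom (coeff p i / of_nat (Suc i)) (Suc i))"
  have "pderiv Q = (\<Sum>i\<le>degree p. monom (coeff p i) i)"
    unfolding Q_def pderiv_sum by (intro sum.cong) (auto simp: pderiv_monom simp del: of_nat_Suc)
  then show ?thesis using that by (simp add: poly_as_sum_of_monoms)
qed

lemma cell_average_pderiv:
  assumes "h > 0"
  shows "cell_average a h (pderiv G) k
    = (poly G (of_real (face a h k)) - poly G (of_real (face a h (k - 1)))) / of_real h"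
proof -
  have "((\<lambda>x. poly (pderiv G) (complex_of_real x)) has_integral
      poly G (of_real (face a h k)) - poly G (of_real (face a h (k - 1)))) {face a h (k - 1)..face a h k}"
  proof (rule fundamental_theorem_of_calculus)
    show "face a h (k - 1) \<le> face a h k" using assms by (simp add: face_def algebra_simps)
    show "((\<lambda>x. poly G (complex_of_real x)) has_vector_derivative poly (pderiv G) (of_real x))
        (at x within {face a h (k - 1)..face a h k})" for x
      by (intro has_vector_derivative_real_field poly_DERIV)
  qed
  then show ?thesis
    by (simp add: cell_average_def integral_unique scaleR_conv_of_real field_simps)
qed

text \<open>The substitution sends the leftmost face of the stencil, \<open>j - l\<close>, to 0 and
  rescales by \<open>1 / h\<close>, so the flux face \<open>j\<close> becomes node
  \<open>l\<close>.\<close>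

definition from_unit_grid :: "real \<Rightarrow> real \<Rightarrow> nat \<Rightarrow> int \<Rightarrow> complex poly \<Rightarrow> complex poly" where
  "from_unit_grid a h l j p =
     pcompose p [:- of_real (face a h (j - int l) / h), of_real (1 / h):]"

lemma poly_from_unit_grid:
  assumes "h > 0"
  shows "poly (from_unit_grid a h l j p) (of_real (face a h (j - int l + int m))) = poly p (of_nat m)"
proof -
  have "- of_real (face a h (j - int l) / h) + of_real (face a h (j - int l + int m)) * of_real (1 / h)
      = complex_of_real (real m)"
    unfolding of_real_mult[symmetric] of_real_minus[symmetric] of_real_add[symmetric]
    using assms by (simp add: face_def field_simps del: of_real_divide of_real_mult of_real_add)
  then show ?thesis by (simp add: from_unit_grid_def poly_pcompose)
qed

lemma pderiv_from_unit_grid: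
  "pderiv (from_unit_grid a h l j p) = smult (of_real (1 / h)) (from_unit_grid a h l j (pderiv p))"
  by (simp add: from_unit_grid_def pderiv_pcompose pderiv_pCons mult.commute)

lemma degree_from_unit_grid [simp]: "h > 0 \<Longrightarrow> degree (from_unit_grid a h l j p) = degree p"
  by (simp add: from_unit_grid_def degree_pcompose)

lemma from_unit_grid_surj:
  assumes "h > 0"
  obtains p where "P = from_unit_grid a h l j p"
proof
  let ?b = "complex_of_real (face a h (j - int l))"
  have "from_unit_grid a h l j (pcompose P [:?b, of_real h:]) = pcompose P [:0, 1:]"
    unfolding from_unit_grid_def pcompose_assoc[symmetric] using assms
    by (intro arg_cong[where f = "pcompose P"]) (simp add: pcompose_pCons)
  then show "P = from_unit_grid a h l j (pcompose P [:?b, of_real h:])" by simp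
qed

lemma cell_average_from_unit_grid:
  assumes "h > 0"
  shows "cell_average a h (from_unit_grid a h l j (pderiv Q)) (j - int l + int (Suc m))
    = poly Q (of_nat (Suc m)) - poly Q (of_nat m)"
proof -
  have "from_unit_grid a h l j (pderiv Q) = pderiv (smult (of_real h) (from_unit_grid a h l j Q))"
    using assms by (simp add: pderiv_smult pderiv_from_unit_grid)
  moreover have "j - int l + int (Suc m) - 1 = j - int l + int m" by simp
  ultimately show ?thesis
    using assms
    by (simp only: cell_average_pderiv[OF assms] poly_smult poly_from_unit_grid[OF assms])
      (simp add: right_diff_distrib[symmetric])
qed

lemma cell_average_pderiv_from_unit_grid:
  assumes "h > 0"
  shows "cell_average a h (pderiv (from_unit_grid a h l j p)) (j - int l + int (Suc m))
    = (poly p (of_nat (Suc m)) - poly p (of_nat m)) / of_real h"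
proof -
  have "j - int l + int (Suc m) - 1 = j - int l + int m" by simp
  then show ?thesis
    by (simp only: cell_average_pderiv[OF assms] poly_from_unit_grid[OF assms])
qed

text \<open>Averages of the pulled-back derivative of \<open>Q\<close> are differences of
  \<open>Q\<close>. Averages of its derivative carry a factor \<open>1 / h\<close> from the chain
  rule, hence the \<open>h\<close> in front of \<open>v\<close>.\<close>

lemma hermite_interpolant_from_unit_grid:
  assumes "h > 0" "l + r > 0"
  shows "hermite_interpolant a h l r u v j (from_unit_grid a h l j (pderiv Q)) \<longleftrightarrow>
    unit_interpolant (l + r) (\<lambda>m. u (j - int l + int (Suc m)))
      (\<lambda>m. of_real h * v (j - int l + int (Suc m))) Q"
proof -
  have "bij_betw (\<lambda>m. - int l + int (Suc m)) {..<l + r} {- int l + 1..int r}"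
    by (rule bij_betw_byWitness[where f' = "\<lambda>k. nat (k + int l - 1)"]) auto
  then have img: "{- int l + 1..int r} = (\<lambda>m. - int l + int (Suc m)) ` {..<l + r}"
    by (rule bij_betw_imp_surj_on[symmetric])
  have ball: "(\<forall>k\<in>{- int l + 1..int r}. B k) \<longleftrightarrow> (\<forall>m<l + r. B (- int l + int (Suc m)))" for B
    unfolding img by blast
  have shift: "j + (- int l + int (Suc m)) = j - int l + int (Suc m)" for m by simp
  \<comment> \<open>Positivity of \<open>l + r\<close> keeps the natural-number subtraction from
    truncating.\<close>
  have deg: "degree (pderiv Q) \<le> 2 * l + 2 * r - 1 \<longleftrightarrow> degree Q \<le> 2 * (l + r)"
    using assms(2) by (auto simp: degree_pderiv)
  have scale: "x / of_real h = y \<longleftrightarrow> x = of_real h * y" for x y :: complex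
    using assms(1) by (auto simp: field_simps)
  show ?thesis
    unfolding hermite_interpolant_def unit_interpolant_def ball shift
      cell_average_from_unit_grid[OF assms(1)] cell_average_pderiv_from_unit_grid[OF assms(1)]
      degree_from_unit_grid[OF assms(1)] deg scale ..
qed

text \<open>Every competing interpolant is the pullback of a polynomial with an antiderivative
  \<open>S\<close> that solves the same unit problem, whose solutions all share one
  derivative.\<close>

lemma reconstruction_eq:
  assumes "h > 0" "l + r > 0"
    and Q: "unit_interpolant (l + r) (\<lambda>m. u (j - int l + int (Suc m)))
      (\<lambda>m. of_real h * v (j - int l + int (Suc m))) Q"
  shows "reconstruction a h l r u v j = from_unit_grid a h l j (pderiv Q)"
  unfolding reconstruction_def
proof (rule the_equality)
  show "hermite_interpolant a h l r u v j (from_unit_grid a h l j (pderiv Q))"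
    using Q by (simp add: hermite_interpolant_from_unit_grid[OF assms(1,2)])
  fix P assume P: "hermite_interpolant a h l r u v j P"
  obtain p where p: "P = from_unit_grid a h l j p" by (rule from_unit_grid_surj[OF assms(1)])
  obtain S where S: "pderiv S = p" by (rule poly_antiderivative)
  have "unit_interpolant (l + r) (\<lambda>m. u (j - int l + int (Suc m)))
      (\<lambda>m. of_real h * v (j - int l + int (Suc m))) S"
    using P hermite_interpolant_from_unit_grid[OF assms(1,2), of a u v j S] by (simp only: p S)
  then show "P = from_unit_grid a h l j (pderiv Q)"
    using unit_interpolant_unique[OF _ Q] p S by auto
qed

lemma flux_eq:
  assumes "h > 0" "l + r > 0"
    and "unit_interpolant (l + r) (\<lambda>m. u (j - int l + int (Suc m)))
      (\<lambda>m. of_real h * v (j - int l + int (Suc m))) Q"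
  shows "flux_F a h l r u v j = poly (pderiv Q) (of_nat l)"
    "flux_H a h l r u v j = poly (pderiv (pderiv Q)) (of_nat l) / of_real h"
  using poly_from_unit_grid[OF assms(1), of a l j _ l]
  by (simp_all add: flux_F_def flux_H_def reconstruction_eq[OF assms] pderiv_from_unit_grid)

section \<open>The von Neumann matrix of the alternating mode\<close>

lemma unit_interpolant_combine:
  assumes "unit_interpolant n U1 V1 Q1" "unit_interpolant n U2 V2 Q2"
  shows "unit_interpolant n (\<lambda>m. c1 * U1 m + c2 * U2 m) (\<lambda>m. c1 * V1 m + c2 * V2 m)
    (smult c1 Q1 + smult c2 Q2)"
  unfolding unit_interpolant_def
proof (intro conjI allI impI)
  show "degree (smult c1 Q1 + smult c2 Q2) \<le> 2 * n"
    using assms unfolding unit_interpolant_def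
    by (intro degree_add_le order.trans[OF degree_smult_le]) auto
  fix m assume "m < n"
  then have *: "U1 m = poly Q1 (of_nat (Suc m)) - poly Q1 (of_nat m)"
    "U2 m = poly Q2 (of_nat (Suc m)) - poly Q2 (of_nat m)"
    "V1 m = poly (pderiv Q1) (of_nat (Suc m)) - poly (pderiv Q1) (of_nat m)"
    "V2 m = poly (pderiv Q2) (of_nat (Suc m)) - poly (pderiv Q2) (of_nat m)"
    using assms unfolding unit_interpolant_def by auto
  show "poly (smult c1 Q1 + smult c2 Q2) (of_nat (Suc m)) - poly (smult c1 Q1 + smult c2 Q2) (of_nat m)
    = c1 * U1 m + c2 * U2 m"
    unfolding * by (simp add: algebra_simps del: of_nat_Suc)
  show "poly (pderiv (smult c1 Q1 + smult c2 Q2)) (of_nat (Suc m))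
      - poly (pderiv (smult c1 Q1 + smult c2 Q2)) (of_nat m) = c1 * V1 m + c2 * V2 m"
    unfolding * by (simp add: pderiv_add pderiv_smult algebra_simps del: of_nat_Suc)
qed

lemma exp_grid_mode_pi:
  "exp (\<i> * of_int (j + int k) * of_real pi) = (- 1) ^ k * exp (\<i> * of_int j * of_real pi)"
proof (induction k)
  case (Suc k)
  have "exp (\<i> * of_int (j + int (Suc k)) * of_real pi)
      = exp (\<i> * of_int (j + int k) * of_real pi) * exp (of_real pi * \<i>)"
    unfolding exp_add[symmetric] by (simp add: algebra_simps)
  then show ?case using Suc by (simp add: exp_pi_i)
qed simp

text \<open>The mode changes sign from cell to cell, so each flux difference is twice the flux.
  \<open>QA\<close> and \<open>QB\<close> are the responses to unit amplitudes in the two data; the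
  second column gains a factor \<open>h\<close> because the unit problem uses \<open>h\<close> times
  \<open>v\<close>.\<close>

lemma von_neumann_matrix_pi:
  assumes h: "h > 0" and "l + r > 0"
    and QA: "unit_interpolant (l + r) (\<lambda>m. (- 1) ^ (l + 1 + m)) (\<lambda>_. 0) QA"
    and QB: "unit_interpolant (l + r) (\<lambda>_. 0) (\<lambda>m. (- 1) ^ (l + 1 + m)) QB"
    and M: "M $ 1 $ 1 = 2 / of_real h * poly (pderiv QA) (of_nat l)"
      "M $ 1 $ 2 = 2 * poly (pderiv QB) (of_nat l)"
      "M $ 2 $ 1 = 2 / (of_real h)\<^sup>2 * poly (pderiv (pderiv QA)) (of_nat l)"
      "M $ 2 $ 2 = 2 / of_real h * poly (pderiv (pderiv QB)) (of_nat l)"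
  shows "von_neumann_matrix a h l r pi M"
  unfolding von_neumann_matrix_def
proof (intro allI)
  fix w :: "real \<Rightarrow> complex^2" and s :: real
  define \<sigma> where "\<sigma> j = exp (\<i> * of_int j * of_real pi)" for j
  have \<sigma>0: "\<sigma> j \<noteq> 0" for j by (simp add: \<sigma>_def)
  have shift: "\<sigma> (j - int l + int (Suc m)) = \<sigma> j * (- 1) ^ (l + 1 + m)" for j m
  proof -
    have "\<sigma> j = (- 1) ^ l * \<sigma> (j - int l)"
      using exp_grid_mode_pi[of "j - int l" l] by (simp add: \<sigma>_def)
    moreover have "\<sigma> (j - int l + int (Suc m)) = (- 1) ^ Suc m * \<sigma> (j - int l)"
      using exp_grid_mode_pi[of "j - int l" "Suc m"] unfolding \<sigma>_def .
    ultimately show ?thesis by (simp add: power_add)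
  qed
  have prev: "\<sigma> (j - 1) = - \<sigma> j" for j
    using exp_grid_mode_pi[of "j - 1" 1] by (simp add: \<sigma>_def)
  let ?u = "\<lambda>j. w s $ 1 * \<sigma> j" and ?v = "\<lambda>j. w s $ 2 * \<sigma> j"
  define F where "F = w s $ 1 * poly (pderiv QA) (of_nat l)
    + of_real h * w s $ 2 * poly (pderiv QB) (of_nat l)"
  define H where "H = (w s $ 1 * poly (pderiv (pderiv QA)) (of_nat l)
    + of_real h * w s $ 2 * poly (pderiv (pderiv QB)) (of_nat l)) / of_real h"
  have interp: "unit_interpolant (l + r) (\<lambda>m. ?u (j - int l + int (Suc m)))
      (\<lambda>m. of_real h * ?v (j - int l + int (Suc m)))
      (smult (\<sigma> j * w s $ 1) QA + smult (\<sigma> j * of_real h * w s $ 2) QB)" for j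
    using unit_interpolant_combine[OF QA QB, of "\<sigma> j * w s $ 1" "\<sigma> j * of_real h * w s $ 2"]
    unfolding shift by (simp add: mult_ac)
  have F: "flux_F a h l r ?u ?v j = \<sigma> j * F" for j
    unfolding flux_eq(1)[OF h assms(2) interp]
    by (simp add: F_def pderiv_add pderiv_smult algebra_simps)
  have H: "flux_H a h l r ?u ?v j = \<sigma> j * H" for j
    unfolding flux_eq(2)[OF h assms(2) interp]
    by (simp add: H_def pderiv_add pderiv_smult algebra_simps add_divide_distrib)
  \<comment> \<open>Dividing by the nonzero \<open>\<sigma> j\<close> collapses the equations for
    all \<open>j\<close> into one.\<close>
  have mode: "((\<lambda>s. f s * \<sigma> j) has_vector_derivative - ((1 / h) *\<^sub>R (\<sigma> j * G - \<sigma> (j - 1) * G))) (at s)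
      \<longleftrightarrow> (f has_vector_derivative - (2 / of_real h * G)) (at s)" for f :: "real \<Rightarrow> complex" and G j
  proof
    assume "(f has_vector_derivative - (2 / of_real h * G)) (at s)"
    from has_vector_derivative_mult_left[OF this, of "\<sigma> j"]
    show "((\<lambda>s. f s * \<sigma> j) has_vector_derivative - ((1 / h) *\<^sub>R (\<sigma> j * G - \<sigma> (j - 1) * G))) (at s)"
      by (simp add: prev scaleR_conv_of_real field_simps)
  next
    assume "((\<lambda>s. f s * \<sigma> j) has_vector_derivative - ((1 / h) *\<^sub>R (\<sigma> j * G - \<sigma> (j - 1) * G))) (at s)"
    from has_vector_derivative_mult_left[OF this, of "1 / \<sigma> j"]
    show "(f has_vector_derivative - (2 / of_real h * G)) (at s)"
      using \<sigma>0[of j] by (simp add: prev scaleR_conv_of_real field_simps)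
  qed
  have Mw: "(M *v w s) $ 1 = 2 / of_real h * F" "(M *v w s) $ 2 = 2 / of_real h * H"
    using h by (simp_all add: matrix_vector_mult_def sum_2 M F_def H_def field_simps power2_eq_square)
  show "scheme_at a h l r
      (\<lambda>s j. w s $ 1 * exp (\<i> * of_int j * of_real pi))
      (\<lambda>s j. w s $ 2 * exp (\<i> * of_int j * of_real pi)) s
    \<longleftrightarrow> (w has_vector_derivative - (M *v w s)) (at s)"
    unfolding scheme_at_def \<sigma>_def[symmetric] F H mode has_vector_derivative_vec_iff forall_2
    by (simp add: Mw)
qed

theorem theorem4p1:
  fixes t :: nat and a h :: real
  assumes "h > 0"
  shows "von_neumann_unstable a h (t + 3) t"
proof -
  let ?l = "t + 3"
  \<comment> \<open>With \<open>s = t + 1\<close> there are \<open>2 * s + 1\<close> cells,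
    \<open>?l = s + 2\<close> and \<open>s \<ge> 1\<close>, the setting of both sign lemmas.\<close>
  have n: "?l + t = 2 * (t + 1) + 1" by simp
  obtain QA :: "complex poly" where QA: "unit_interpolant (?l + t) (\<lambda>m. (- 1) ^ (?l + 1 + m)) (\<lambda>_. 0) QA"
    by (rule unit_interpolant_exists)
  obtain QB :: "complex poly" where QB: "unit_interpolant (?l + t) (\<lambda>_. 0) (\<lambda>m. (- 1) ^ (?l + 1 + m)) QB"
    by (rule unit_interpolant_exists)
  let ?A = "poly (pderiv QA) (of_nat ?l)" and ?D = "poly (pderiv (pderiv QB)) (of_nat ?l)"
  define M :: "complex^2^2" where "M = vector
    [vector [2 / of_real h * ?A, 2 * poly (pderiv QB) (of_nat ?l)],
     vector [2 / (of_real h)\<^sup>2 * poly (pderiv (pderiv QA)) (of_nat ?l), 2 / of_real h * ?D]]"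
  have "von_neumann_matrix a h ?l t pi M"
    by (rule von_neumann_matrix_pi[OF assms _ QA QB]) (simp_all add: M_def)
  moreover have "Re ?A < 0"
    using flux_F_sign[OF QA[unfolded n], of ?l] by simp
  moreover have "Re ?D < 0"
    using flux_H_sign[OF QB[unfolded n]] by simp
  ultimately have "Re (M $ 1 $ 1 + M $ 2 $ 2) < 0"
    using assms by (auto simp: M_def intro!: add_neg_neg divide_neg_pos)
  then obtain \<mu> where "eigenvalue_of M \<mu>" "Re \<mu> < 0"
    using eigenvalue_of_trace_neg by blast
  moreover have "pi \<in> {0..2 * pi}" by simp
  ultimately show ?thesis
    unfolding von_neumann_unstable_def
    using \<open>von_neumann_matrix a h ?l t pi M\<close> by blast
qed

end
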